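(* Let $(\xi_i)_{i\in\mathbb Z}$ be a sequence of centered, non essentially constant, square integrable real-valued random variables on a probability space. Let $(k_n)_{n\ge 1}$ be a nondecreasing sequence of positive integers with $k_n\to+\infty$, and let $\{a_{n,i},\ -k_n\le i\le k_n\}$ be a triangular array of real numbers such that $\sum_{i=-k_n}^{k_n}a_{n,i}^2>0$ for all $n$. Put $$\Sigma_n=\sum_{i=-k_n}^{k_n}a_{n,i}\,\xi_i,\qquad \sigma_n^2=\operatorname{Var}(\Sigma_n).$$ Assume that: (A1)(i) $\displaystyle\liminf_{n\to+\infty}\frac{\sigma_n^2}{\sum_{i=-k_n}^{k_n}a_{n,i}^2}>0$; (A1)(ii) $\displaystyle\lim_{n\to+\infty}\sigma_n^{-1}\max_{-k_n\le i\le k_n}|a_{n,i}|=0$; (A2) the family $\{\xi_i^2\}_{i\in\mathbb Z}$ is uniformly integrable; (A3) there is a function $g:(0,\infty)\to[0,\infty)$ such that $\theta_2^{\xi}(n)\le g(n)$ for all integers $n\ge1$, the map $x\mapsto x^{3/2}g(x)$ is non-increasing, and there exists $\varepsilon\in(0,1)$ with $\sum_{i=0}^{\infty}2^{3i/2}g(2^{i\varepsilon})<\infty$. Then, as $n\to\infty$, $\Sigma_n/\sigma_n$ converges in distribution to the standard normal law $\mathcal N(0,1)$.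
   Context: The dependence coefficient $\theta_2^\xi(n)$ is defined as follows. On $\mathbb R^m$ let $d_1(x,y)=\sum_{i=1}^m|x_i-y_i|$. Let $\tilde\Lambda$ be the set of all functions $f:\mathbb R^m\to\mathbb R$ (for some $m\ge1$) that are Lipschitz with respect to $d_1$ with Lipschitz constant at most $1$. For a square integrable $\mathbb R^m$-valued random variable $Y$ and a $\sigma$-algebra $\mathcal M$, set $$\theta_2(\mathcal M,Y)=\sup\{\|\mathbb E(f(Y)\mid\mathcal M)-\mathbb E(f(Y))\|_2:\ f\in\tilde\Lambda,\ f \text{ defined on } \mathbb R^m\}.$$ With $\mathcal M_i=\sigma(\xi_j,\ j\le i)$, $i\in\mathbb Z$, set for $k\in\mathbb N^*\cup\{\infty\}$ $$\theta_{k,2}^\xi(n)=\sup_{1\le l\le k,\ l<\infty}\frac1l\sup\{\theta_2(\mathcal M_p,(\xi_{j_1},\dots,\xi_{j_l})):\ p\in\mathbb Z,\ p+n\le j_1<\dots<j_l\},\qquad \theta_2^\xi(n)=\theta_{\infty,2}^\xi(n)=\sup_{k\in\mathbb N^*}\theta_{k,2}^\xi(n).$$ *)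

theory Defs
  imports "HOL-Probability.Probability"
begin

text \<open>
  The space \<open>\<real>\<^sup>m\<close> is the set of extensional functions on \<open>{1..m}\<close>, that is, the space of
  \<open>Pi\<^sub>M {1..m} (\<lambda>_. borel)\<close>; this lets \<open>m\<close> vary inside a formula.
\<close>

definition real_space :: "nat \<Rightarrow> (nat \<Rightarrow> real) set" where
  "real_space m = {1..m} \<rightarrow>\<^sub>E UNIV"

definition d1 :: "nat \<Rightarrow> (nat \<Rightarrow> real) \<Rightarrow> (nat \<Rightarrow> real) \<Rightarrow> real" where
  "d1 m x y = (\<Sum>i=1..m. \<bar>x i - y i\<bar>)"

definition lip1 :: "nat \<Rightarrow> ((nat \<Rightarrow> real) \<Rightarrow> real) set" where
  "lip1 m = {f. \<forall>x\<in>real_space m. \<forall>y\<in>real_space m. \<bar>f x - f y\<bar> \<le> d1 m x y}"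

text \<open>The case distinction is needed because the Bochner integral of a
  non-integrable function is \<open>0\<close>.\<close>

definition L2_norm :: "'a measure \<Rightarrow> ('a \<Rightarrow> real) \<Rightarrow> ennreal" where
  "L2_norm M h =
     (if integrable M (\<lambda>\<omega>. (h \<omega>)\<^sup>2) then ennreal (sqrt (\<integral>\<omega>. (h \<omega>)\<^sup>2 \<partial>M)) else \<infinity>)"

text \<open>Here \<open>F\<close> is a sub-\<open>\<sigma>\<close>-algebra of \<open>M\<close>, and \<open>Y\<close> is square integrable with values in
  \<open>real_space m\<close>.\<close>

definition theta2 :: "'a measure \<Rightarrow> 'a measure \<Rightarrow> nat \<Rightarrow> ('a \<Rightarrow> nat \<Rightarrow> real) \<Rightarrow> ennreal" where
  "theta2 M F m Y =
     (SUP f\<in>lip1 m.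
        L2_norm M (\<lambda>\<omega>. real_cond_exp M F (\<lambda>\<omega>'. f (Y \<omega>')) \<omega> - (\<integral>\<omega>'. f (Y \<omega>') \<partial>M)))"

definition past :: "'a measure \<Rightarrow> (int \<Rightarrow> 'a \<Rightarrow> real) \<Rightarrow> int \<Rightarrow> 'a measure" where
  "past M \<xi> i = sigma (space M) (\<Union>j\<in>{..i}. {\<xi> j -` A \<inter> space M |A. A \<in> sets borel})"

definition theta_k :: "'a measure \<Rightarrow> (int \<Rightarrow> 'a \<Rightarrow> real) \<Rightarrow> enat \<Rightarrow> nat \<Rightarrow> ennreal" where
  "theta_k M \<xi> k n =
     (SUP l\<in>{l::nat. 1 \<le> l \<and> enat l \<le> k}.
        ennreal (1 / real l) *
        (SUP (p, j)\<in>{(p::int, j::nat \<Rightarrow> int). p + int n \<le> j 1 \<and> strict_mono_on {1..l} j}.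
           theta2 M (past M \<xi> p) l (\<lambda>\<omega>. \<lambda>i\<in>{1..l}. \<xi> (j i) \<omega>)))"

definition theta :: "'a measure \<Rightarrow> (int \<Rightarrow> 'a \<Rightarrow> real) \<Rightarrow> nat \<Rightarrow> ennreal" where
  "theta M \<xi> n = theta_k M \<xi> \<infinity> n"

lemma theta_eq_SUP: "theta M \<xi> n = (SUP k\<in>{k::nat. 1 \<le> k}. theta_k M \<xi> (enat k) n)"
proof (rule antisym)
  show "theta M \<xi> n \<le> (SUP k\<in>{k::nat. 1 \<le> k}. theta_k M \<xi> (enat k) n)"
    unfolding theta_def theta_k_def[of M \<xi> \<infinity>]
  proof (rule SUP_least, goal_cases)
    case (1 l)
    show ?case
      by (rule SUP_upper2[of l]) (use 1 in \<open>auto simp: theta_k_def intro!: SUP_upper\<close>)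
  qed
  show "(SUP k\<in>{k::nat. 1 \<le> k}. theta_k M \<xi> (enat k) n) \<le> theta M \<xi> n"
    unfolding theta_def theta_k_def by (intro SUP_least SUP_upper) auto
qed

definition uniformly_integrable ::
  "'a measure \<Rightarrow> 'i set \<Rightarrow> ('i \<Rightarrow> 'a \<Rightarrow> real) \<Rightarrow> bool" where
  "uniformly_integrable M I X \<longleftrightarrow>
     (\<forall>i\<in>I. X i \<in> borel_measurable M) \<and>
     ((\<lambda>c::real. SUP i\<in>I. \<integral>\<^sup>+\<omega>. ennreal \<bar>X i \<omega>\<bar> * indicator {\<omega>. \<bar>X i \<omega>\<bar> > c} \<omega> \<partial>M)
        \<longlongrightarrow> 0) at_top"

definition array_sum ::
  "(nat \<Rightarrow> nat) \<Rightarrow> (nat \<Rightarrow> int \<Rightarrow> real) \<Rightarrow> (int \<Rightarrow> 'a \<Rightarrow> real) \<Rightarrow> nat \<Rightarrow> 'a \<Rightarrow> real" where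
  "array_sum k a \<xi> n \<omega> = (\<Sum>i=-int (k n)..int (k n). a n i * \<xi> i \<omega>)"

definition array_sd ::
  "'a measure \<Rightarrow> (nat \<Rightarrow> nat) \<Rightarrow> (nat \<Rightarrow> int \<Rightarrow> real) \<Rightarrow> (int \<Rightarrow> 'a \<Rightarrow> real) \<Rightarrow> nat \<Rightarrow> real" where
  "array_sd M k a \<xi> n = sqrt (prob_space.variance M (array_sum k a \<xi> n))"

end

theory Submission
  imports Defs
begin

text \<open>
  The proof compares characteristic functions along the partial sums, in the spirit of Lindeberg.
  After normalisation the sum is \<open>S\<^sub>N = X\<^sub>0 + \<dots> + X\<^bsub>N-1\<^esub>\<close> with \<open>X\<^sub>j = w\<^sub>j \<xi>\<^bsub>s+j\<^esub>\<close>, where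
  \<open>max \<bar>w\<^sub>j\<bar>\<close> is small, \<open>\<Sum> w\<^sub>j\<^sup>2\<close> is bounded and \<open>Var S\<^sub>N = 1\<close>. Put \<open>u\<^sub>j = E exp(i t S\<^sub>j)\<close> and let
  \<open>V\<^sub>j = E X\<^sub>j\<^sup>2 + 2 \<Sum>\<^bsub>i<j\<^esub> E X\<^sub>i X\<^sub>j\<close> be the increment of the variance of the partial sums. The claim is
  that \<open>u\<close> almost satisfies the recursion of a Gaussian characteristic function,
  \<open>u\<^bsub>j+1\<^esub> = (1 - t\<^sup>2 V\<^sub>j / 2) u\<^sub>j + r\<^sub>j\<close>, with errors whose sum tends to \<open>0\<close>. Then \<open>u\<^sub>N\<close> is close to
  \<open>exp(- t\<^sup>2 Var S\<^sub>N / 2)\<close>, and Levy's continuity theorem gives the convergence in law.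

  To second order, \<open>u\<^bsub>j+1\<^esub> - u\<^sub>j\<close> is \<open>i t E[exp(i t S\<^sub>j) X\<^sub>j] - t\<^sup>2/2 E[exp(i t S\<^sub>j) X\<^sub>j\<^sup>2]\<close>. In the first
  term the factor \<open>exp(i t S\<^sub>j)\<close> is telescoped over the indices \<open>i < j\<close>, so that it becomes the sum of
  \<open>i t E[(exp(i t S\<^bsub>i+1\<^esub>) - exp(i t S\<^sub>i)) X\<^sub>j]\<close>, and each summand should be
  \<open>- t\<^sup>2 u\<^sub>j E[X\<^sub>i X\<^sub>j]\<close>. The difference is controlled in two ways. For any \<open>i < j\<close>, conditioning \<open>X\<^sub>j\<close>
  on the past up to \<open>i\<close> gives a bound of order \<open>\<bar>w\<^sub>i w\<^sub>j\<bar> \<theta>\<^sub>2(j - i)\<close> (\<open>pair_error_far\<close>), which is summable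
  in \<open>j - i\<close>. For \<open>j - i\<close> bounded it is \<open>o(\<bar>w\<^sub>i w\<^sub>j\<bar>)\<close> as \<open>max \<bar>w\<bar> \<longlonglongrightarrow> 0\<close> (\<open>pair_error_near\<close>): the sum
  \<open>S\<^sub>i\<close> may be cut a fixed number of indices earlier at negligible cost, and a product
  \<open>\<xi>\<^sub>i \<xi>\<^sub>j\<close>, truncated by uniform integrability so as to be a Lipschitz function of two coordinates, is
  asymptotically uncorrelated with a distant past (\<open>product_decorrelates\<close>). The square \<open>X\<^sub>j\<^sup>2\<close> is the
  case \<open>i = j\<close> of the same fact. Because \<open>\<bar>w\<^sub>i w\<^sub>j\<bar> \<le> (w\<^sub>i\<^sup>2 + w\<^sub>j\<^sup>2) / 2\<close>, all errors sum to a small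
  multiple of \<open>\<Sum> w\<^sub>j\<^sup>2\<close> (\<open>sum_convolution_le\<close>), whatever the number of summands.

  The dependence enters through the summability of \<open>\<theta>\<^sub>2(n)\<close>, and \<open>\<theta>\<^sub>2(n) \<le> g(n) \<le> g(1) n\<^bsup>-3/2\<^esup>\<close>
  follows from the monotonicity of \<open>x \<mapsto> x\<^bsup>3/2\<^esup> g(x)\<close>.
\<close>

section \<open>Covariances and the dependence coefficient\<close>

lemma integrable_mult_of_squares:
  fixes f g :: "'a \<Rightarrow> real"
  assumes [measurable]: "f \<in> borel_measurable M" "g \<in> borel_measurable M"
    and "integrable M (\<lambda>x. (f x)\<^sup>2)" "integrable M (\<lambda>x. (g x)\<^sup>2)"
  shows "integrable M (\<lambda>x. f x * g x)"
proof (rule Bochner_Integration.integrable_bound)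
  show "integrable M (\<lambda>x. (f x)\<^sup>2 + (g x)\<^sup>2)"
    using assms by simp
  have "\<bar>a * b\<bar> \<le> a\<^sup>2 + b\<^sup>2" for a b :: real
    using sum_squares_bound[of "\<bar>a\<bar>" "\<bar>b\<bar>"] abs_ge_zero[of "a * b"]
    unfolding abs_mult power2_abs by linarith
  then show "AE x in M. norm (f x * g x) \<le> norm ((f x)\<^sup>2 + (g x)\<^sup>2)"
    by (auto intro!: AE_I2)
qed simp

lemma integral_abs_mult_le:
  fixes f g :: "'a \<Rightarrow> real"
  assumes [measurable]: "f \<in> borel_measurable M" "g \<in> borel_measurable M"
    and f2: "integrable M (\<lambda>x. (f x)\<^sup>2)" and g2: "integrable M (\<lambda>x. (g x)\<^sup>2)"
  shows "(\<integral>x. \<bar>f x * g x\<bar> \<partial>M) \<le> sqrt (\<integral>x. (f x)\<^sup>2 \<partial>M) * sqrt (\<integral>x. (g x)\<^sup>2 \<partial>M)"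
proof -
  have fg: "integrable M (\<lambda>x. \<bar>f x * g x\<bar>)"
    using integrable_mult_of_squares[OF assms] by (rule integrable_abs)
  have "(\<integral>\<^sup>+x. ennreal \<bar>f x\<bar> * ennreal \<bar>g x\<bar> \<partial>M)\<^sup>2
      \<le> (\<integral>\<^sup>+x. (ennreal \<bar>f x\<bar>)\<^sup>2 \<partial>M) * (\<integral>\<^sup>+x. (ennreal \<bar>g x\<bar>)\<^sup>2 \<partial>M)"
    by (rule Cauchy_Schwarz_nn_integral) auto
  also have "(\<integral>\<^sup>+x. ennreal \<bar>f x\<bar> * ennreal \<bar>g x\<bar> \<partial>M) = ennreal (\<integral>x. \<bar>f x * g x\<bar> \<partial>M)"
    using nn_integral_eq_integral[OF fg] by (simp add: ennreal_mult'[symmetric] abs_mult)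
  also have "(\<integral>\<^sup>+x. (ennreal \<bar>f x\<bar>)\<^sup>2 \<partial>M) = ennreal (\<integral>x. (f x)\<^sup>2 \<partial>M)"
    using nn_integral_eq_integral[OF f2] by (simp add: ennreal_power)
  also have "(\<integral>\<^sup>+x. (ennreal \<bar>g x\<bar>)\<^sup>2 \<partial>M) = ennreal (\<integral>x. (g x)\<^sup>2 \<partial>M)"
    using nn_integral_eq_integral[OF g2] by (simp add: ennreal_power)
  finally have "(\<integral>x. \<bar>f x * g x\<bar> \<partial>M)\<^sup>2 \<le> (\<integral>x. (f x)\<^sup>2 \<partial>M) * (\<integral>x. (g x)\<^sup>2 \<partial>M)"
    by (simp add: ennreal_power ennreal_mult'[symmetric])
  then show ?thesis
    by (metis real_le_rsqrt real_sqrt_mult)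
qed

text \<open>
  Since \<open>Z\<close> is measurable with respect to the conditioning \<open>\<sigma>\<close>-algebra, \<open>W\<close> may be replaced by its
  conditional expectation inside the integral; the rest is Cauchy-Schwarz.
\<close>
lemma covariance_le_L2_norm:
  fixes Z W :: "'a \<Rightarrow> real"
  assumes "prob_space M" "subalgebra M F"
    and Z: "Z \<in> borel_measurable F" "integrable M (\<lambda>x. (Z x)\<^sup>2)"
    and W: "W \<in> borel_measurable M" "integrable M (\<lambda>x. (W x)\<^sup>2)"
    and c: "0 \<le> c"
    and le: "L2_norm M (\<lambda>x. real_cond_exp M F W x - (\<integral>y. W y \<partial>M)) \<le> ennreal c"
  shows "\<bar>\<integral>x. Z x * (W x - (\<integral>y. W y \<partial>M)) \<partial>M\<bar> \<le> sqrt (\<integral>x. (Z x)\<^sup>2 \<partial>M) * c"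
proof -
  interpret prob_space M by fact
  interpret finite_measure_subalgebra M F
    using \<open>subalgebra M F\<close> by unfold_locales
  note [measurable] = measurable_from_subalg[OF \<open>subalgebra M F\<close> Z(1)] W(1)
  define D where "D x = real_cond_exp M F W x - expectation W" for x
  have [measurable]: "D \<in> borel_measurable M"
    unfolding D_def by measurable
  have D2: "integrable M (\<lambda>x. (D x)\<^sup>2)" and Dc: "sqrt (\<integral>x. (D x)\<^sup>2 \<partial>M) \<le> c"
    using le c unfolding L2_norm_def D_def[symmetric]
    by (auto split: if_splits simp: top_unique)
  have ZW: "integrable M (\<lambda>x. Z x * W x)"
    using Z W by (intro integrable_mult_of_squares) auto
  have Zi: "integrable M Z"
    by (rule square_integrable_imp_integrable) (use Z in auto)
  have "(\<integral>x. Z x * (W x - expectation W) \<partial>M) = (\<integral>x. Z x * D x \<partial>M)"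
    using real_cond_exp_intg[OF ZW Z(1) W(1)] ZW Zi
    by (simp add: D_def right_diff_distrib)
  also have "\<bar>\<dots>\<bar> \<le> (\<integral>x. \<bar>Z x * D x\<bar> \<partial>M)"
    by (rule integral_abs_bound)
  also have "\<dots> \<le> sqrt (\<integral>x. (Z x)\<^sup>2 \<partial>M) * sqrt (\<integral>x. (D x)\<^sup>2 \<partial>M)"
    using Z D2 by (intro integral_abs_mult_le) auto
  also have "\<dots> \<le> sqrt (\<integral>x. (Z x)\<^sup>2 \<partial>M) * c"
    using Dc by (intro mult_left_mono) auto
  finally show ?thesis .
qed

text \<open>
  The real and the imaginary part of \<open>Z\<close> are treated separately, whence the factor \<open>2\<close>.
\<close>
lemma complex_covariance_le_L2_norm:
  fixes Z :: "'a \<Rightarrow> complex" and W :: "'a \<Rightarrow> real"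
  assumes "prob_space M" "subalgebra M F"
    and Z: "Z \<in> borel_measurable F" "integrable M (\<lambda>x. (cmod (Z x))\<^sup>2)"
    and W: "W \<in> borel_measurable M" "integrable M (\<lambda>x. (W x)\<^sup>2)"
    and c: "0 \<le> c"
    and le: "L2_norm M (\<lambda>x. real_cond_exp M F W x - (\<integral>y. W y \<partial>M)) \<le> ennreal c"
  shows "cmod (\<integral>x. Z x * of_real (W x - (\<integral>y. W y \<partial>M)) \<partial>M)
    \<le> 2 * sqrt (\<integral>x. (cmod (Z x))\<^sup>2 \<partial>M) * c"
proof -
  interpret prob_space M by fact
  note [measurable] = measurable_from_subalg[OF \<open>subalgebra M F\<close> Z(1)] W(1)
  note [measurable (raw)] = borel_measurable_Re borel_measurable_Im
  let ?m = "\<integral>y. W y \<partial>M"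
  have part: "integrable M (\<lambda>x. (g (Z x))\<^sup>2)
      \<and> \<bar>\<integral>x. g (Z x) * (W x - ?m) \<partial>M\<bar> \<le> sqrt (\<integral>x. (cmod (Z x))\<^sup>2 \<partial>M) * c
      \<and> integrable M (\<lambda>x. g (Z x) * (W x - ?m))"
    if g[measurable]: "g \<in> borel_measurable borel" and le_cmod: "\<And>z. \<bar>g z\<bar> \<le> cmod z" for g
  proof -
    have sq: "(g z)\<^sup>2 \<le> (cmod z)\<^sup>2" for z
      using le_cmod[of z] by (simp add: abs_le_square_iff[symmetric])
    have int: "integrable M (\<lambda>x. (g (Z x))\<^sup>2)"
      by (rule Bochner_Integration.integrable_bound[OF Z(2)]) (auto simp: sq intro!: AE_I2)
    have "(\<lambda>x. g (Z x)) \<in> borel_measurable F"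
      using measurable_compose[OF Z(1) g] .
    from covariance_le_L2_norm[OF assms(1,2) this int W c le]
    have "\<bar>\<integral>x. g (Z x) * (W x - ?m) \<partial>M\<bar> \<le> sqrt (\<integral>x. (g (Z x))\<^sup>2 \<partial>M) * c" .
    also have "\<dots> \<le> sqrt (\<integral>x. (cmod (Z x))\<^sup>2 \<partial>M) * c"
      using c by (intro mult_right_mono real_sqrt_le_mono integral_mono int Z(2) sq)
    finally have 1: "\<bar>\<integral>x. g (Z x) * (W x - ?m) \<partial>M\<bar> \<le> sqrt (\<integral>x. (cmod (Z x))\<^sup>2 \<partial>M) * c" .
    have "integrable M (\<lambda>x. g (Z x) * W x)"
      using int W by (intro integrable_mult_of_squares) auto
    moreover have "integrable M (\<lambda>x. g (Z x))"
      by (rule square_integrable_imp_integrable) (use int in auto)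
    ultimately have "integrable M (\<lambda>x. g (Z x) * (W x - ?m))"
      by (simp add: right_diff_distrib)
    with int 1 show ?thesis by blast
  qed
  let ?f = "\<lambda>x. Z x * of_real (W x - ?m)"
  have re: "integrable M (\<lambda>x. Re (?f x))" and im: "integrable M (\<lambda>x. Im (?f x))"
    using part[of Re] part[of Im] by (auto simp: abs_Re_le_cmod abs_Im_le_cmod)
  have int: "integrable M ?f"
  proof -
    have "integrable M (\<lambda>x. of_real (Re (?f x)) + \<i> * of_real (Im (?f x)))"
      using re im by (intro Bochner_Integration.integrable_add integrable_mult_right integrable_of_real)
    then show ?thesis by (simp only: complex_eq[symmetric])
  qed
  have "cmod (\<integral>x. ?f x \<partial>M) \<le> \<bar>\<integral>x. Re (?f x) \<partial>M\<bar> + \<bar>\<integral>x. Im (?f x) \<partial>M\<bar>"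
    unfolding integral_Re[OF int] integral_Im[OF int] by (rule cmod_le)
  also have "\<dots> \<le> sqrt (\<integral>x. (cmod (Z x))\<^sup>2 \<partial>M) * c + sqrt (\<integral>x. (cmod (Z x))\<^sup>2 \<partial>M) * c"
    using part[of Re] part[of Im] by (intro add_mono) (auto simp: abs_Re_le_cmod abs_Im_le_cmod)
  finally show ?thesis by (simp add: mult_ac)
qed

lemma subalgebra_past:
  assumes "\<And>i. \<xi> i \<in> borel_measurable M"
  shows "subalgebra M (past M \<xi> p)"
  unfolding subalgebra_def past_def
  using assms by (auto intro!: sets.sigma_sets_subset simp: sets_measure_of_conv space_measure_of_conv)

lemma measurable_past:
  assumes "j \<le> p"
  shows "\<xi> j \<in> borel_measurable (past M \<xi> p)"
proof (rule measurableI)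
  fix A :: "real set" assume "A \<in> sets borel"
  then show "\<xi> j -` A \<inter> space (past M \<xi> p) \<in> sets (past M \<xi> p)"
    using assms unfolding past_def
    by (auto simp: space_measure_of_conv sets_measure_of_conv intro!: sigma_sets.Basic)
qed simp

text \<open>
  Undoing the normalisation by \<open>1 / l\<close> in the definition of the coefficient.
\<close>
lemma theta2_le_of_theta_le:
  assumes le: "theta M \<xi> n \<le> ennreal c" and c: "0 \<le> c"
    and l: "1 \<le> l" and j: "p + int n \<le> j 1" "strict_mono_on {1..l} j"
  shows "theta2 M (past M \<xi> p) l (\<lambda>\<omega>. \<lambda>i\<in>{1..l}. \<xi> (j i) \<omega>) \<le> ennreal (real l * c)"
    (is "?T \<le> _")
proof -
  have "ennreal (1 / real l) * ?T \<le> theta M \<xi> n"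
    unfolding theta_def theta_k_def
    by (rule SUP_upper2[of l], use l in simp, rule mult_left_mono,
        rule SUP_upper2[of "(p, j)"]) (use j in auto)
  with le have "ennreal (1 / real l) * ?T \<le> ennreal c" by simp
  then have "ennreal (real l) * (ennreal (1 / real l) * ?T) \<le> ennreal (real l) * ennreal c"
    by (rule mult_left_mono) simp
  moreover have "ennreal (real l) * (ennreal (1 / real l) * ?T) = ?T"
    using l by (simp add: mult.assoc[symmetric] ennreal_mult'[symmetric])
  ultimately show ?thesis
    using c by (simp add: ennreal_mult')
qed

lemma L2_norm_le_theta2:
  assumes "f \<in> lip1 m"
  shows "L2_norm M (\<lambda>\<omega>. real_cond_exp M F (\<lambda>\<omega>'. f (Y \<omega>')) \<omega> - (\<integral>\<omega>'. f (Y \<omega>') \<partial>M))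
    \<le> theta2 M F m Y"
  unfolding theta2_def by (rule SUP_upper) (rule assms)


section \<open>Truncation and Taylor estimates\<close>

definition trunc :: "real \<Rightarrow> real \<Rightarrow> real" where
  "trunc A x = max (- A) (min x A)"

lemma trunc_measurable [measurable]: "trunc A \<in> borel_measurable borel"
  unfolding trunc_def[abs_def] by measurable

lemma abs_trunc_le: "0 \<le> A \<Longrightarrow> \<bar>trunc A x\<bar> \<le> A"
  and abs_trunc_le_abs: "0 \<le> A \<Longrightarrow> \<bar>trunc A x\<bar> \<le> \<bar>x\<bar>"
  and trunc_lipschitz: "\<bar>trunc A x - trunc A y\<bar> \<le> \<bar>x - y\<bar>"
  and abs_diff_trunc_le: "0 \<le> A \<Longrightarrow> \<bar>x - trunc A x\<bar> \<le> \<bar>x\<bar> * indicator {A<..} \<bar>x\<bar>"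
  by (auto simp: trunc_def indicator_def)

lemma trunc_mult_lipschitz:
  assumes "0 \<le> A"
  shows "\<bar>trunc A x * trunc A y - trunc A x' * trunc A y'\<bar> \<le> A * (\<bar>x - x'\<bar> + \<bar>y - y'\<bar>)"
proof -
  have "\<bar>trunc A x * trunc A y - trunc A x' * trunc A y'\<bar>
      = \<bar>trunc A x * (trunc A y - trunc A y') + trunc A y' * (trunc A x - trunc A x')\<bar>"
    by (simp add: algebra_simps)
  also have "\<dots> \<le> \<bar>trunc A x\<bar> * \<bar>trunc A y - trunc A y'\<bar> + \<bar>trunc A y'\<bar> * \<bar>trunc A x - trunc A x'\<bar>"
    by (metis abs_mult abs_triangle_ineq)
  also have "\<dots> \<le> A * \<bar>y - y'\<bar> + A * \<bar>x - x'\<bar>"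
    using assms by (intro add_mono mult_mono abs_trunc_le trunc_lipschitz) auto
  finally show ?thesis by (simp add: algebra_simps)
qed

lemma cmod_iexp_diff_le: "cmod (iexp x - iexp y) \<le> \<bar>x - y\<bar>"
proof -
  have "iexp x - iexp y = iexp y * (iexp (x - y) - 1)"
    by (simp add: right_diff_distrib exp_add[symmetric])
  then show ?thesis
    using iexp_approx1[of "x - y" 0] by (simp add: norm_mult)
qed

text \<open>
  The quadratic Taylor bound serves for \<open>\<bar>x\<bar> \<le> A\<close> and the linear one beyond; in both cases a factor
  \<open>\<bar>c\<bar>\<close> is kept in front, because the errors are eventually compared with products of two weights.
\<close>
lemma iexp_first_order_error:
  assumes "\<bar>c\<bar> \<le> \<gamma>" "0 \<le> A"
  shows "cmod (iexp (c * x) - 1 - \<i> * of_real (c * x))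
    \<le> \<bar>c\<bar> * (\<gamma> * A * \<bar>x\<bar> + 2 * (\<bar>x\<bar> * indicator {A<..} \<bar>x\<bar>))"
proof (cases "\<bar>x\<bar> \<le> A")
  case True
  have "cmod (iexp (c * x) - 1 - \<i> * of_real (c * x)) \<le> \<bar>c * x\<bar>\<^sup>2 / 2"
    using iexp_approx1[of "c * x" 1] by (simp add: numeral_2_eq_2 diff_diff_eq)
  also have "\<dots> \<le> \<bar>c * x\<bar>\<^sup>2" by simp
  also have "\<dots> = \<bar>c\<bar> * (\<bar>c\<bar> * (\<bar>x\<bar> * \<bar>x\<bar>))" by (simp add: power2_eq_square abs_mult mult_ac)
  also have "\<dots> \<le> \<bar>c\<bar> * (\<gamma> * (A * \<bar>x\<bar>))"
    using assms True by (intro mult_left_mono mult_mono mult_right_mono) auto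
  finally show ?thesis using True by (simp add: mult.assoc)
next
  case False
  have "cmod (iexp (c * x) - 1 - \<i> * of_real (c * x)) \<le> 2 * \<bar>c * x\<bar>"
    using iexp_approx2[of "c * x" 1] by (simp add: diff_diff_eq)
  also have "\<dots> \<le> \<bar>c\<bar> * (\<gamma> * A * \<bar>x\<bar> + 2 * \<bar>x\<bar>)"
  proof -
    have "0 \<le> \<bar>c\<bar> * (\<gamma> * A * \<bar>x\<bar>)" using assms by (intro mult_nonneg_nonneg) auto
    then show ?thesis by (simp add: abs_mult distrib_left)
  qed
  finally show ?thesis using False by simp
qed

lemma iexp_second_order_error:
  assumes "\<bar>c\<bar> \<le> \<gamma>" "0 \<le> A"
  shows "cmod (iexp (c * x) - 1 - (\<i> * of_real (c * x) - of_real ((c * x)\<^sup>2 / 2)))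
    \<le> c\<^sup>2 * (\<gamma> * A * x\<^sup>2 + x\<^sup>2 * indicator {A<..} \<bar>x\<bar>)"
proof -
  have taylor: "iexp (c * x) - (\<Sum>k\<le>2. (\<i> * (c * x)) ^ k / fact k)
      = iexp (c * x) - 1 - (\<i> * of_real (c * x) - of_real ((c * x)\<^sup>2 / 2))"
    by (simp add: numeral_2_eq_2 power_mult_distrib algebra_simps)
  show ?thesis
  proof (cases "\<bar>x\<bar> \<le> A")
    case True
    have "cmod (iexp (c * x) - 1 - (\<i> * of_real (c * x) - of_real ((c * x)\<^sup>2 / 2)))
        \<le> \<bar>c * x\<bar> ^ 3 / fact 3"
      using iexp_approx1[of "c * x" 2] unfolding taylor by (simp add: numeral_3_eq_3 numeral_2_eq_2)
    also have "\<dots> \<le> \<bar>c * x\<bar> ^ 3" by (simp add: fact_numeral)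
    also have "\<dots> = c\<^sup>2 * ((\<bar>c\<bar> * \<bar>x\<bar>) * x\<^sup>2)"
      by (simp add: power3_eq_cube power2_eq_square abs_mult mult_ac)
    also have "\<dots> \<le> c\<^sup>2 * ((\<gamma> * A) * x\<^sup>2)"
      using assms True by (intro mult_left_mono mult_right_mono mult_mono) auto
    finally show ?thesis using True by simp
  next
    case False
    have "cmod (iexp (c * x) - 1 - (\<i> * of_real (c * x) - of_real ((c * x)\<^sup>2 / 2))) \<le> (c * x)\<^sup>2"
      using iexp_approx2[of "c * x" 2] unfolding taylor by simp
    also have "\<dots> = c\<^sup>2 * x\<^sup>2" by (simp add: power_mult_distrib)
    also have "\<dots> \<le> c\<^sup>2 * (\<gamma> * A * x\<^sup>2 + x\<^sup>2)"
      using assms by (intro mult_left_mono) auto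
    finally show ?thesis using False by simp
  qed
qed


section \<open>Recursions and convolution sums\<close>

lemma abs_exp_minus_first_order:
  fixes y :: real
  assumes "\<bar>y\<bar> \<le> 1"
  shows "\<bar>exp (- y) - (1 - y)\<bar> \<le> y\<^sup>2"
proof -
  have ge: "1 - y \<le> exp (- y)" using exp_ge_add_one_self[of "- y"] by simp
  have "exp (- y) \<le> 1 - y + y\<^sup>2"
  proof (cases "0 \<le> y")
    case True
    have "exp (- y) * (1 + y) \<le> exp (- y) * exp y"
      using exp_ge_add_one_self[of y] by (intro mult_left_mono) auto
    also have "\<dots> = 1" by (simp add: exp_minus_inverse mult.commute)
    also have "\<dots> \<le> 1 + y ^ 3" using True by simp
    also have "\<dots> = (1 - y + y\<^sup>2) * (1 + y)"
      by (simp add: algebra_simps power2_eq_square power3_eq_cube)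
    finally show ?thesis using True by (simp add: mult_le_cancel_right)
  next
    case False
    then show ?thesis using exp_bound[of "- y"] assms by simp
  qed
  with ge show ?thesis by linarith
qed

text \<open>
  Multiplying by the integrating factor \<open>exp(v\<^sub>0 + \<dots> + v\<^bsub>j-1\<^esub>)\<close> turns the recursion into a telescoping sum.
  Since the increments \<open>v\<^sub>j\<close> may have either sign, the integrating factors need not be monotone and are
  bounded through \<open>C\<close>.
\<close>
lemma perturbed_exponential_recursion:
  fixes u r :: "nat \<Rightarrow> complex" and v :: "nat \<Rightarrow> real"
  assumes u0: "u 0 = 1" and u_le: "\<And>j. cmod (u j) \<le> 1"
    and rec: "\<And>j. u (Suc j) = of_real (1 - v j) * u j + r j"
    and v: "\<And>j. \<bar>v j\<bar> \<le> 1" and C: "\<And>n. n \<le> N \<Longrightarrow> exp (\<Sum>j<n. v j) \<le> C"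
    and nonneg: "0 \<le> (\<Sum>j<N. v j)"
  shows "cmod (u N - of_real (exp (- (\<Sum>j<N. v j)))) \<le> C * (\<Sum>j<N. cmod (r j) + (v j)\<^sup>2)"
proof -
  define V where "V n = (\<Sum>j<n. v j)" for n
  have C0: "0 \<le> C" using C[of 0] by simp
  have "cmod (of_real (exp (V n)) * u n - 1) \<le> C * (\<Sum>j<n. cmod (r j) + (v j)\<^sup>2)" if "n \<le> N" for n
    using that
  proof (induction n)
    case 0
    then show ?case by (simp add: V_def u0)
  next
    case (Suc n)
    have V: "V (Suc n) = V n + v n" by (simp add: V_def)
    have "of_real (exp (V (Suc n))) * u (Suc n) - of_real (exp (V n)) * u n
        = of_real (exp (V (Suc n))) * (r n - of_real (exp (- v n) - (1 - v n)) * u n)"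
    proof -
      have "exp (V n) = exp (V (Suc n)) * exp (- v n)"
        unfolding V by (simp add: exp_add[symmetric])
      then have "complex_of_real (exp (V n)) = of_real (exp (V (Suc n))) * of_real (exp (- v n))"
        by (simp only: of_real_mult)
      then show ?thesis
        unfolding rec by (simp only: of_real_diff of_real_1) (simp only: algebra_simps)
    qed
    moreover have "cmod (of_real (exp (V (Suc n))) * (r n - of_real (exp (- v n) - (1 - v n)) * u n))
        \<le> C * (cmod (r n) + (v n)\<^sup>2)"
    proof -
      have "cmod (of_real (exp (- v n) - (1 - v n)) * u n) \<le> (v n)\<^sup>2 * 1"
        unfolding norm_mult norm_of_real
        by (intro mult_mono abs_exp_minus_first_order v u_le) auto
      then have "cmod (r n - of_real (exp (- v n) - (1 - v n)) * u n) \<le> cmod (r n) + (v n)\<^sup>2"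
        by (intro norm_triangle_le_diff) auto
      then show ?thesis
        unfolding norm_mult norm_of_real using C[of "Suc n"] Suc.prems C0
        by (intro mult_mono) (auto simp: V_def)
    qed
    ultimately have "cmod ((of_real (exp (V (Suc n))) * u (Suc n) - of_real (exp (V n)) * u n)
        + (of_real (exp (V n)) * u n - 1))
        \<le> C * (cmod (r n) + (v n)\<^sup>2) + C * (\<Sum>j<n. cmod (r j) + (v j)\<^sup>2)"
      using Suc by (intro norm_triangle_le add_mono) auto
    then show ?case by (simp add: distrib_left add.commute)
  qed
  then have le: "cmod (of_real (exp (V N)) * u N - 1) \<le> C * (\<Sum>j<N. cmod (r j) + (v j)\<^sup>2)" by simp
  have "complex_of_real (exp (- V N)) * of_real (exp (V N)) = 1"
    unfolding of_real_mult[symmetric] exp_add[symmetric] by simp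
  then have "u N - of_real (exp (- V N)) = of_real (exp (- V N)) * (of_real (exp (V N)) * u N - 1)"
    by (simp only: right_diff_distrib mult.assoc[symmetric] mult_1 mult_1_right)
  then have "cmod (u N - of_real (exp (- V N))) = exp (- V N) * cmod (of_real (exp (V N)) * u N - 1)"
    by (simp only: norm_mult norm_of_real) simp
  also have "\<dots> \<le> 1 * cmod (of_real (exp (V N)) * u N - 1)"
    using nonneg by (intro mult_right_mono) (auto simp: V_def)
  finally show ?thesis using le by (simp add: V_def)
qed

lemma sum_reindexed_le:
  fixes h :: "nat \<Rightarrow> real"
  assumes "\<And>F. finite F \<Longrightarrow> sum h F \<le> H" "finite S" "inj_on d S"
  shows "(\<Sum>i\<in>S. h (d i)) \<le> H"
  using assms(1)[of "d ` S"] assms(2,3) by (simp add: sum.reindex)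

text \<open>
  The analogue of Young's inequality for a convolution with an absolutely summable kernel. It holds
  uniformly in the number of summands.
\<close>
lemma sum_convolution_le:
  fixes w h :: "nat \<Rightarrow> real"
  assumes h: "\<And>n. 0 \<le> h n" and H: "\<And>F. finite F \<Longrightarrow> sum h F \<le> H"
  shows "(\<Sum>j<N. \<Sum>i<j. \<bar>w i\<bar> * \<bar>w j\<bar> * h (j - i)) \<le> H * (\<Sum>j<N. (w j)\<^sup>2)"
proof -
  have "(\<Sum>j<N. \<Sum>i<j. \<bar>w i\<bar> * \<bar>w j\<bar> * h (j - i))
      \<le> (\<Sum>j<N. \<Sum>i<j. (w i)\<^sup>2 / 2 * h (j - i) + (w j)\<^sup>2 / 2 * h (j - i))"
  proof (intro sum_mono)
    fix i j
    have "\<bar>w i\<bar> * \<bar>w j\<bar> \<le> (w i)\<^sup>2 / 2 + (w j)\<^sup>2 / 2"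
      using sum_squares_bound[of "\<bar>w i\<bar>" "\<bar>w j\<bar>"] by simp
    then show "\<bar>w i\<bar> * \<bar>w j\<bar> * h (j - i) \<le> (w i)\<^sup>2 / 2 * h (j - i) + (w j)\<^sup>2 / 2 * h (j - i)"
      unfolding distrib_right[symmetric] by (rule mult_right_mono) (rule h)
  qed
  also have "\<dots> = (\<Sum>j<N. \<Sum>i<j. (w i)\<^sup>2 / 2 * h (j - i)) + (\<Sum>j<N. \<Sum>i<j. (w j)\<^sup>2 / 2 * h (j - i))"
    by (simp add: sum.distrib)
  also have "(\<Sum>j<N. \<Sum>i<j. (w i)\<^sup>2 / 2 * h (j - i)) \<le> (\<Sum>i<N. (w i)\<^sup>2 / 2 * H)"
  proof -
    have "(\<Sum>j<N. \<Sum>i<j. (w i)\<^sup>2 / 2 * h (j - i))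
        = (\<Sum>j<N. \<Sum>i\<in>{i\<in>{..<N}. i < j}. (w i)\<^sup>2 / 2 * h (j - i))"
      by (intro sum.cong) auto
    also have "\<dots> = (\<Sum>i<N. \<Sum>j\<in>{j\<in>{..<N}. i < j}. (w i)\<^sup>2 / 2 * h (j - i))"
      by (rule sum.swap_restrict) auto
    also have "\<dots> \<le> (\<Sum>i<N. (w i)\<^sup>2 / 2 * H)"
      unfolding sum_distrib_left[symmetric]
      by (intro sum_mono mult_left_mono sum_reindexed_le[OF H]) (auto intro!: inj_onI)
    finally show ?thesis .
  qed
  also have "(\<Sum>j<N. \<Sum>i<j. (w j)\<^sup>2 / 2 * h (j - i)) \<le> (\<Sum>j<N. (w j)\<^sup>2 / 2 * H)"
    unfolding sum_distrib_left[symmetric]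
    by (intro sum_mono mult_left_mono sum_reindexed_le[OF H]) (auto intro!: inj_onI)
  also have "(\<Sum>i<N. (w i)\<^sup>2 / 2 * H) + (\<Sum>j<N. (w j)\<^sup>2 / 2 * H) = H * (\<Sum>j<N. (w j)\<^sup>2)"
    by (simp add: sum.distrib[symmetric] sum_distrib_left mult.commute)
  finally show ?thesis by simp
qed


section \<open>Moments and covariances of a dependent sequence\<close>

text \<open>
  The array enters only through weights and a position on the time axis. Everything below is therefore
  stated for the sequence alone, with thresholds that depend on neither, so that it applies to all
  rows of the array at once.
\<close>
locale theta_dependent = prob_space M for M :: "'a measure" +
  fixes \<xi> :: "int \<Rightarrow> 'a \<Rightarrow> real" and \<rho> :: "nat \<Rightarrow> real"
  assumes meas [measurable]: "\<And>i. \<xi> i \<in> borel_measurable M"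
    and square_integrable: "\<And>i. integrable M (\<lambda>\<omega>. (\<xi> i \<omega>)\<^sup>2)"
    and centered: "\<And>i. expectation (\<xi> i) = 0"
    and unif_integrable: "uniformly_integrable M UNIV (\<lambda>i \<omega>. (\<xi> i \<omega>)\<^sup>2)"
    and theta_le: "\<And>n. 1 \<le> n \<Longrightarrow> theta M \<xi> n \<le> ennreal (\<rho> n)"
    and rate_nonneg: "\<And>n. 0 \<le> \<rho> n"
    and rate_summable: "summable \<rho>"
begin

lemma integrable_mult: "integrable M (\<lambda>\<omega>. \<xi> i \<omega> * \<xi> j \<omega>)"
  by (rule integrable_mult_of_squares) (auto simp: square_integrable)

lemma integrable: "integrable M (\<xi> i)"
  by (rule square_integrable_imp_integrable) (auto simp: square_integrable)

lemma square_tail_integrable: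
  "integrable M (\<lambda>\<omega>. (\<xi> i \<omega>)\<^sup>2 * indicator {A<..} \<bar>\<xi> i \<omega>\<bar>)"
  by (rule Bochner_Integration.integrable_bound[OF square_integrable[of i]])
     (auto intro!: AE_I2 simp: indicator_def)

text \<open>
  The level \<open>A \<ge> 1\<close> makes \<open>\<bar>x\<bar> > A\<close> imply \<open>x\<^sup>2 > A\<close>, so one level works for \<open>\<xi>\<close> and for \<open>\<xi>\<^sup>2\<close>.
\<close>
lemma uniform_square_tail:
  assumes "0 < \<tau>"
  shows "\<exists>A\<ge>1. \<forall>i. expectation (\<lambda>\<omega>. (\<xi> i \<omega>)\<^sup>2 * indicator {A<..} \<bar>\<xi> i \<omega>\<bar>) \<le> \<tau>"
proof -
  let ?I = "\<lambda>c i. \<integral>\<^sup>+\<omega>. ennreal \<bar>(\<xi> i \<omega>)\<^sup>2\<bar> * indicator {\<omega>. \<bar>(\<xi> i \<omega>)\<^sup>2\<bar> > c} \<omega> \<partial>M"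
  have "((\<lambda>c::real. SUP i. ?I c i) \<longlongrightarrow> 0) at_top"
    using unif_integrable unfolding uniformly_integrable_def by blast
  moreover have "0 < ennreal \<tau>" using assms by simp
  ultimately have "eventually (\<lambda>c. (SUP i. ?I c i) < ennreal \<tau>) at_top"
    by (rule order_tendstoD)
  then obtain c where c: "c \<ge> 1" "(SUP i. ?I c i) < ennreal \<tau>"
    using eventually_conj[OF _ eventually_ge_at_top[of 1]] eventually_happens'[OF trivial_limit_at_top_linorder]
    by (smt (verit, del_insts) eventually_at_top_linorder)
  have "expectation (\<lambda>\<omega>. (\<xi> i \<omega>)\<^sup>2 * indicator {c<..} \<bar>\<xi> i \<omega>\<bar>) \<le> \<tau>" for i
  proof -
    have "c < x\<^sup>2" if "c < \<bar>x\<bar>" for x :: real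
    proof -
      have "\<bar>x\<bar> * 1 \<le> \<bar>x\<bar> * \<bar>x\<bar>" using that c(1) by (intro mult_left_mono) auto
      with that show ?thesis by (simp add: power2_eq_square)
    qed
    then have "ennreal (expectation (\<lambda>\<omega>. (\<xi> i \<omega>)\<^sup>2 * indicator {c<..} \<bar>\<xi> i \<omega>\<bar>)) \<le> ?I c i"
      by (subst nn_integral_eq_integral[OF square_tail_integrable, symmetric])
         (auto intro!: nn_integral_mono simp: indicator_def)
    also have "\<dots> \<le> (SUP i. ?I c i)" by (rule SUP_upper) simp
    finally have "ennreal (expectation (\<lambda>\<omega>. (\<xi> i \<omega>)\<^sup>2 * indicator {c<..} \<bar>\<xi> i \<omega>\<bar>)) < ennreal \<tau>"
      using c(2) by (rule le_less_trans)
    then show ?thesis using assms by (simp add: ennreal_less_iff)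
  qed
  with c(1) show ?thesis by blast
qed

text \<open>
  The supremum of the \<open>L\<^sup>2\<close> norms, finite by uniform integrability.
\<close>
definition \<kappa> :: real where
  "\<kappa> = sqrt (SUP i. expectation (\<lambda>\<omega>. (\<xi> i \<omega>)\<^sup>2))"

lemma L2_le: "sqrt (expectation (\<lambda>\<omega>. (\<xi> i \<omega>)\<^sup>2)) \<le> \<kappa>"
proof -
  obtain A where A: "\<And>i. expectation (\<lambda>\<omega>. (\<xi> i \<omega>)\<^sup>2 * indicator {A<..} \<bar>\<xi> i \<omega>\<bar>) \<le> 1" "A \<ge> 1"
    using uniform_square_tail[of 1] by auto
  have "expectation (\<lambda>\<omega>. (\<xi> i \<omega>)\<^sup>2) \<le> A\<^sup>2 + 1" for i
  proof -
    have sq: "x\<^sup>2 \<le> A\<^sup>2" if "\<not> A < \<bar>x\<bar>" for x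
      using that A(2) abs_le_square_iff[of x A] by auto
    have "expectation (\<lambda>\<omega>. (\<xi> i \<omega>)\<^sup>2)
        \<le> expectation (\<lambda>\<omega>. A\<^sup>2 + (\<xi> i \<omega>)\<^sup>2 * indicator {A<..} \<bar>\<xi> i \<omega>\<bar>)"
      using sq by (intro integral_mono square_integrable Bochner_Integration.integrable_add
          square_tail_integrable) (auto simp: indicator_def)
    also have "\<dots> = A\<^sup>2 + expectation (\<lambda>\<omega>. (\<xi> i \<omega>)\<^sup>2 * indicator {A<..} \<bar>\<xi> i \<omega>\<bar>)"
      by (simp add: square_tail_integrable prob_space)
    also have "\<dots> \<le> A\<^sup>2 + 1" using A by simp
    finally show ?thesis .
  qed
  then show ?thesis
    unfolding \<kappa>_def by (intro real_sqrt_le_mono cSUP_upper bdd_aboveI2[where M="A\<^sup>2 + 1"]) auto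
qed

lemma \<kappa>_nonneg: "0 \<le> \<kappa>"
  by (rule order_trans[OF _ L2_le[of 0]]) simp

lemma expectation_square_le: "expectation (\<lambda>\<omega>. (\<xi> i \<omega>)\<^sup>2) \<le> \<kappa>\<^sup>2"
  using L2_le[of i] \<kappa>_nonneg by (simp add: sqrt_le_D)

lemma expectation_abs_mult_le:
  assumes [measurable]: "f \<in> borel_measurable M" and "integrable M (\<lambda>\<omega>. (f \<omega>)\<^sup>2)"
    and le: "sqrt (expectation (\<lambda>\<omega>. (f \<omega>)\<^sup>2)) \<le> b"
  shows "expectation (\<lambda>\<omega>. \<bar>f \<omega> * \<xi> j \<omega>\<bar>) \<le> b * \<kappa>"
proof -
  have "expectation (\<lambda>\<omega>. \<bar>f \<omega> * \<xi> j \<omega>\<bar>)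
      \<le> sqrt (expectation (\<lambda>\<omega>. (f \<omega>)\<^sup>2)) * sqrt (expectation (\<lambda>\<omega>. (\<xi> j \<omega>)\<^sup>2))"
    using assms square_integrable by (intro integral_abs_mult_le) auto
  also have "\<dots> \<le> b * \<kappa>"
    by (intro mult_mono le L2_le order_trans[OF _ le]) auto
  finally show ?thesis .
qed

lemma expectation_abs_le: "expectation (\<lambda>\<omega>. \<bar>\<xi> j \<omega>\<bar>) \<le> \<kappa>"
  using expectation_abs_mult_le[of "\<lambda>_. 1" 1 j] by (simp add: prob_space)

lemma expectation_abs_mult: "expectation (\<lambda>\<omega>. \<bar>\<xi> i \<omega> * \<xi> j \<omega>\<bar>) \<le> \<kappa>\<^sup>2"
  using expectation_abs_mult_le[OF meas square_integrable L2_le, of i j]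
  by (simp add: power2_eq_square)

lemma tail_mult:
  assumes "expectation (\<lambda>\<omega>. (\<xi> i \<omega>)\<^sup>2 * indicator {A<..} \<bar>\<xi> i \<omega>\<bar>) \<le> \<tau>\<^sup>2" "0 \<le> \<tau>"
  shows "integrable M (\<lambda>\<omega>. \<bar>\<xi> i \<omega>\<bar> * indicator {A<..} \<bar>\<xi> i \<omega>\<bar> * \<bar>\<xi> j \<omega>\<bar>)" (is ?int)
    and "expectation (\<lambda>\<omega>. \<bar>\<xi> i \<omega>\<bar> * indicator {A<..} \<bar>\<xi> i \<omega>\<bar> * \<bar>\<xi> j \<omega>\<bar>) \<le> \<tau> * \<kappa>"
proof -
  let ?f = "\<lambda>\<omega>. \<xi> i \<omega> * indicator {A<..} \<bar>\<xi> i \<omega>\<bar>"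
  have f2: "(?f \<omega>)\<^sup>2 = (\<xi> i \<omega>)\<^sup>2 * indicator {A<..} \<bar>\<xi> i \<omega>\<bar>" for \<omega>
    by (auto simp: indicator_def)
  have eq: "\<bar>?f \<omega> * \<xi> j \<omega>\<bar> = \<bar>\<xi> i \<omega>\<bar> * indicator {A<..} \<bar>\<xi> i \<omega>\<bar> * \<bar>\<xi> j \<omega>\<bar>" for \<omega>
    by (auto simp: indicator_def abs_mult)
  have "sqrt (expectation (\<lambda>\<omega>. (?f \<omega>)\<^sup>2)) \<le> \<tau>"
    unfolding f2 using assms by (intro real_le_lsqrt) (auto intro!: integral_nonneg_AE)
  with expectation_abs_mult_le[of ?f \<tau> j]
  show "expectation (\<lambda>\<omega>. \<bar>\<xi> i \<omega>\<bar> * indicator {A<..} \<bar>\<xi> i \<omega>\<bar> * \<bar>\<xi> j \<omega>\<bar>) \<le> \<tau> * \<kappa>"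
    by (simp only: f2 eq square_tail_integrable) simp
  show ?int
    unfolding eq[symmetric]
    by (intro integrable_abs integrable_mult_of_squares)
       (simp_all only: f2 square_tail_integrable square_integrable, simp_all)
qed

lemma covariance_future:
  assumes n: "1 \<le> n" and p: "p + int n \<le> j"
    and Z: "Z \<in> borel_measurable (past M \<xi> p)" "integrable M (\<lambda>\<omega>. (cmod (Z \<omega>))\<^sup>2)"
  shows "cmod (expectation (\<lambda>\<omega>. Z \<omega> * of_real (\<xi> j \<omega>)))
    \<le> 2 * sqrt (expectation (\<lambda>\<omega>. (cmod (Z \<omega>))\<^sup>2)) * \<rho> n"
proof -
  let ?f = "\<lambda>x :: nat \<Rightarrow> real. x 1"
  have "?f \<in> lip1 1" by (auto simp: lip1_def d1_def)
  from L2_norm_le_theta2[OF this, of M "past M \<xi> p" "\<lambda>\<omega>. \<lambda>i\<in>{1..1}. \<xi> j \<omega>"]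
  have "L2_norm M (\<lambda>\<omega>. real_cond_exp M (past M \<xi> p) (\<xi> j) \<omega> - expectation (\<xi> j))
      \<le> theta2 M (past M \<xi> p) 1 (\<lambda>\<omega>. \<lambda>i\<in>{1..1}. \<xi> j \<omega>)" by simp
  also have "\<dots> \<le> ennreal (real 1 * \<rho> n)"
    using p by (intro theta2_le_of_theta_le[where j="\<lambda>_. j" and n=n] theta_le[OF n] rate_nonneg)
      (auto simp: strict_mono_on_def)
  finally have "L2_norm M (\<lambda>\<omega>. real_cond_exp M (past M \<xi> p) (\<xi> j) \<omega> - expectation (\<xi> j))
      \<le> ennreal (\<rho> n)" by simp
  from complex_covariance_le_L2_norm[OF prob_space_axioms subalgebra_past[OF meas] Z meas
      square_integrable rate_nonneg this]
  show ?thesis by (simp add: centered)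
qed

text \<open>
  After division by \<open>2 A\<close> the product of two truncations is \<open>1\<close>-Lipschitz. For \<open>i < j\<close> it is a function
  of two coordinates; for \<open>i = j\<close> it is a function of a single one, as the coefficient only
  admits distinct indices.
\<close>
lemma covariance_future_trunc:
  assumes n: "1 \<le> n" and p: "p + int n \<le> i" "i \<le> j" and A: "1 \<le> A"
    and Z: "Z \<in> borel_measurable (past M \<xi> p)" "\<And>\<omega>. cmod (Z \<omega>) \<le> 1"
  defines "W \<equiv> \<lambda>\<omega>. trunc A (\<xi> i \<omega>) * trunc A (\<xi> j \<omega>)"
  shows "cmod (expectation (\<lambda>\<omega>. Z \<omega> * of_real (W \<omega> - expectation W))) \<le> 8 * A * \<rho> n"
proof -
  note [measurable] = measurable_from_subalg[OF subalgebra_past[OF meas] Z(1)]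
  have [measurable]: "W \<in> borel_measurable M"
    unfolding W_def by measurable
  let ?U = "\<lambda>\<omega>. W \<omega> / (2 * A)"
  let ?F = "past M \<xi> p"
  have L2: "L2_norm M (\<lambda>\<omega>. real_cond_exp M ?F ?U \<omega> - expectation ?U) \<le> ennreal (2 * \<rho> n)"
  proof (cases "i = j")
    case True
    let ?f = "\<lambda>x :: nat \<Rightarrow> real. trunc A (x 1) * trunc A (x 1) / (2 * A)"
    have "?f \<in> lip1 1"
    proof -
      have "\<bar>?f x - ?f y\<bar> \<le> \<bar>x 1 - y 1\<bar>" for x y
        using trunc_mult_lipschitz[of A "x 1" "x 1" "y 1" "y 1"] A
        by (simp add: field_simps abs_divide diff_divide_distrib[symmetric])
      then show ?thesis by (auto simp: lip1_def d1_def)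
    qed
    from L2_norm_le_theta2[OF this, of M ?F "\<lambda>\<omega>. \<lambda>i\<in>{1..1}. \<xi> j \<omega>"] True
    have "L2_norm M (\<lambda>\<omega>. real_cond_exp M ?F ?U \<omega> - expectation ?U)
        \<le> theta2 M ?F 1 (\<lambda>\<omega>. \<lambda>i\<in>{1..1}. \<xi> j \<omega>)" by (simp add: W_def)
    also have "\<dots> \<le> ennreal (real 1 * \<rho> n)"
      using p by (intro theta2_le_of_theta_le[where j="\<lambda>_. j" and n=n] theta_le[OF n] rate_nonneg)
        (auto simp: strict_mono_on_def)
    also have "\<dots> \<le> ennreal (2 * \<rho> n)" using rate_nonneg[of n] by (intro ennreal_leI) simp
    finally show ?thesis .
  next
    case False
    let ?f = "\<lambda>x :: nat \<Rightarrow> real. trunc A (x 1) * trunc A (x 2) / (2 * A)"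
    let ?j = "\<lambda>k :: nat. if k = 1 then i else j"
    have "?f \<in> lip1 2"
    proof -
      have "\<bar>?f x - ?f y\<bar> \<le> \<bar>x 1 - y 1\<bar> + \<bar>x 2 - y 2\<bar>" for x y
      proof -
        have "\<bar>?f x - ?f y\<bar>
            = \<bar>trunc A (x 1) * trunc A (x 2) - trunc A (y 1) * trunc A (y 2)\<bar> / (2 * A)"
          using A by (simp add: abs_divide diff_divide_distrib[symmetric])
        also have "\<dots> \<le> (A * (\<bar>x 1 - y 1\<bar> + \<bar>x 2 - y 2\<bar>)) / (2 * A)"
          using A by (intro divide_right_mono trunc_mult_lipschitz) auto
        also have "\<dots> \<le> \<bar>x 1 - y 1\<bar> + \<bar>x 2 - y 2\<bar>"
          using A by (simp add: field_simps)
        finally show ?thesis .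
      qed
      moreover have "{1..2::nat} = {1, 2}" by auto
      ultimately show ?thesis by (simp add: lip1_def d1_def)
    qed
    from L2_norm_le_theta2[OF this, of M ?F "\<lambda>\<omega>. \<lambda>k\<in>{1..2}. \<xi> (?j k) \<omega>"]
    have "L2_norm M (\<lambda>\<omega>. real_cond_exp M ?F ?U \<omega> - expectation ?U)
        \<le> theta2 M ?F 2 (\<lambda>\<omega>. \<lambda>k\<in>{1..2}. \<xi> (?j k) \<omega>)" by (simp add: W_def)
    also have "\<dots> \<le> ennreal (real 2 * \<rho> n)"
      using p False by (intro theta2_le_of_theta_le[where j="?j" and n=n] theta_le[OF n] rate_nonneg)
        (auto simp: strict_mono_on_def)
    finally show ?thesis by simp
  qed
  have Wle: "\<bar>W \<omega>\<bar> \<le> A * A" for \<omega>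
    unfolding W_def abs_mult using A by (intro mult_mono abs_trunc_le) auto
  have U2: "integrable M (\<lambda>\<omega>. (?U \<omega>)\<^sup>2)"
    using A Wle by (intro integrable_const_bound[where B="(A * A / (2 * A))\<^sup>2"] AE_I2)
      (auto simp: abs_le_square_iff[symmetric] abs_mult pos_divide_le_eq)
  have Z2: "integrable M (\<lambda>\<omega>. (cmod (Z \<omega>))\<^sup>2)"
    using Z(2) by (intro integrable_const_bound[where B=1] AE_I2)
      (auto simp: power_le_one)
  have "expectation (\<lambda>\<omega>. (cmod (Z \<omega>))\<^sup>2) \<le> expectation (\<lambda>_. 1)"
    using Z(2) by (intro integral_mono Z2) (auto simp: power_le_one)
  then have "sqrt (expectation (\<lambda>\<omega>. (cmod (Z \<omega>))\<^sup>2)) \<le> 1" by (simp add: prob_space)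
  then have "2 * sqrt (expectation (\<lambda>\<omega>. (cmod (Z \<omega>))\<^sup>2)) * (2 * \<rho> n) \<le> 2 * 1 * (2 * \<rho> n)"
    using rate_nonneg[of n] by (intro mult_right_mono mult_left_mono) auto
  with complex_covariance_le_L2_norm[OF prob_space_axioms subalgebra_past[OF meas] Z(1) Z2 _ U2 _ L2]
  have "cmod (expectation (\<lambda>\<omega>. Z \<omega> * of_real (?U \<omega> - expectation ?U))) \<le> 4 * \<rho> n"
    using rate_nonneg[of n] by auto
  moreover have "expectation (\<lambda>\<omega>. Z \<omega> * of_real (?U \<omega> - expectation ?U))
      = expectation (\<lambda>\<omega>. Z \<omega> * of_real (W \<omega> - expectation W)) / of_real (2 * A)"
    by (simp add: diff_divide_distrib[symmetric] times_divide_eq_right del: of_real_diff)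
  ultimately show ?thesis
    using A by (simp add: norm_divide field_simps)
qed

section \<open>Characteristic functions of weighted partial sums\<close>

definition psum :: "int \<Rightarrow> (nat \<Rightarrow> real) \<Rightarrow> nat \<Rightarrow> 'a \<Rightarrow> real" where
  "psum s w j \<omega> = (\<Sum>i<j. w i * \<xi> (s + int i) \<omega>)"

text \<open>
  The random phase whose expectation is the characteristic function of the partial sum at \<open>t\<close>.
\<close>
definition wave :: "real \<Rightarrow> int \<Rightarrow> (nat \<Rightarrow> real) \<Rightarrow> nat \<Rightarrow> 'a \<Rightarrow> complex" where
  "wave t s w j \<omega> = iexp (t * psum s w j \<omega>)"

lemma measurable_psum_past:
  assumes "s + int j \<le> p + 1"
  shows "psum s w j \<in> borel_measurable (past M \<xi> p)"
  unfolding psum_def[abs_def]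
  using assms by (intro borel_measurable_sum borel_measurable_times borel_measurable_const measurable_past) auto

lemma measurable_wave_past:
  assumes "s + int j \<le> p + 1"
  shows "wave t s w j \<in> borel_measurable (past M \<xi> p)"
proof -
  have "(\<lambda>x. iexp (t * x)) \<in> borel_measurable borel" by measurable
  from measurable_compose[OF measurable_psum_past[OF assms] this]
  show ?thesis unfolding wave_def[abs_def] .
qed

lemma measurable_psum [measurable]: "psum s w j \<in> borel_measurable M"
  unfolding psum_def[abs_def] by measurable

lemma measurable_wave [measurable]: "wave t s w j \<in> borel_measurable M"
  unfolding wave_def[abs_def] by measurable

lemma cmod_wave [simp]: "cmod (wave t s w j \<omega>) = 1"
  unfolding wave_def by simp

lemma wave_0 [simp]: "wave t s w 0 \<omega> = 1"
  by (simp add: wave_def psum_def)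

lemma wave_Suc: "wave t s w (Suc j) \<omega> = wave t s w j \<omega> * iexp ((t * w j) * \<xi> (s + int j) \<omega>)"
  by (simp add: wave_def psum_def distrib_left exp_add mult_ac)

lemma integrable_wave_mult:
  assumes "integrable M f"
  shows "integrable M (\<lambda>\<omega>. wave t s w j \<omega> * of_real (f \<omega>))"
  by (rule Bochner_Integration.integrable_bound[OF assms])
     (use assms in \<open>auto simp: norm_mult\<close>)

lemma integrable_wave: "integrable M (wave t s w j)"
  using integrable_wave_mult[of "\<lambda>_. 1"] by simp

lemma cmod_expectation_wave_mult_le:
  assumes "integrable M f"
  shows "cmod (expectation (\<lambda>\<omega>. wave t s w j \<omega> * of_real (f \<omega>))) \<le> expectation (\<lambda>\<omega>. \<bar>f \<omega>\<bar>)"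
proof -
  have "cmod (expectation (\<lambda>\<omega>. wave t s w j \<omega> * of_real (f \<omega>)))
      \<le> expectation (\<lambda>\<omega>. cmod (wave t s w j \<omega> * of_real (f \<omega>)))"
    by (rule integral_norm_bound)
  then show ?thesis by (simp add: norm_mult)
qed

lemma cmod_expectation_wave_le_1: "cmod (expectation (wave t s w j)) \<le> 1"
  using cmod_expectation_wave_mult_le[of "\<lambda>_. 1" t s w j] by (simp add: prob_space)

lemma cmod_wave_diff_le:
  assumes "i \<le> j"
  shows "cmod (wave t s w j \<omega> - wave t s w i \<omega>)
    \<le> \<bar>t\<bar> * (\<Sum>l=i..<j. \<bar>w l\<bar> * \<bar>\<xi> (s + int l) \<omega>\<bar>)"
proof -
  have "cmod (wave t s w j \<omega> - wave t s w i \<omega>) \<le> \<bar>t * psum s w j \<omega> - t * psum s w i \<omega>\<bar>"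
    unfolding wave_def by (rule cmod_iexp_diff_le)
  also have "\<dots> = \<bar>t\<bar> * \<bar>psum s w j \<omega> - psum s w i \<omega>\<bar>"
    by (simp add: abs_mult[symmetric] right_diff_distrib)
  also have "psum s w j \<omega> - psum s w i \<omega> = (\<Sum>l=i..<j. w l * \<xi> (s + int l) \<omega>)"
    unfolding psum_def lessThan_atLeast0 using assms by (simp add: sum_diff_nat_ivl)
  also have "\<bar>t\<bar> * \<bar>\<dots>\<bar> \<le> \<bar>t\<bar> * (\<Sum>l=i..<j. \<bar>w l\<bar> * \<bar>\<xi> (s + int l) \<omega>\<bar>)"
    using sum_abs[of "\<lambda>l. w l * \<xi> (s + int l) \<omega>" "{i..<j}"]
    by (intro mult_left_mono) (auto simp: abs_mult)
  finally show ?thesis .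
qed

lemma expectation_cmod_wave_diff_le:
  assumes ij: "i \<le> j" and w: "\<And>l. \<bar>w l\<bar> \<le> \<eta>"
  shows "expectation (\<lambda>\<omega>. cmod (wave t s w j \<omega> - wave t s w i \<omega>)) \<le> \<bar>t\<bar> * real (j - i) * \<eta> * \<kappa>"
proof -
  have "expectation (\<lambda>\<omega>. cmod (wave t s w j \<omega> - wave t s w i \<omega>))
      \<le> expectation (\<lambda>\<omega>. \<bar>t\<bar> * (\<Sum>l=i..<j. \<bar>w l\<bar> * \<bar>\<xi> (s + int l) \<omega>\<bar>))"
    by (intro integral_mono cmod_wave_diff_le ij integrable_norm Bochner_Integration.integrable_diff
        integrable_wave Bochner_Integration.integrable_mult_right Bochner_Integration.integrable_sum
        integrable_abs integrable)
  also have "\<dots> = \<bar>t\<bar> * (\<Sum>l=i..<j. \<bar>w l\<bar> * expectation (\<lambda>\<omega>. \<bar>\<xi> (s + int l) \<omega>\<bar>))"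
    by (simp add: integrable)
  also have "\<dots> \<le> \<bar>t\<bar> * (\<Sum>l=i..<j. \<eta> * \<kappa>)"
    using order_trans[OF abs_ge_zero w[of 0]]
    by (intro mult_left_mono sum_mono mult_mono w expectation_abs_le) auto
  finally show ?thesis using ij by (simp add: mult_ac)
qed

lemma cmod_expectation_wave_diff_mult_le:
  assumes ij: "i \<le> j" and w: "\<And>l. \<bar>w l\<bar> \<le> \<eta>"
    and f[measurable]: "f \<in> borel_measurable M" and b: "\<And>\<omega>. \<bar>f \<omega>\<bar> \<le> b"
  shows "cmod (expectation (\<lambda>\<omega>. (wave t s w j \<omega> - wave t s w i \<omega>) * of_real (f \<omega>)))
    \<le> \<bar>t\<bar> * real (j - i) * \<eta> * \<kappa> * b"
proof -
  have int: "integrable M (\<lambda>\<omega>. cmod (wave t s w j \<omega> - wave t s w i \<omega>) * c)" for c :: real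
    by (intro integrable_norm Bochner_Integration.integrable_diff integrable_wave
        Bochner_Integration.integrable_mult_left)
  have "cmod (expectation (\<lambda>\<omega>. (wave t s w j \<omega> - wave t s w i \<omega>) * of_real (f \<omega>)))
      \<le> expectation (\<lambda>\<omega>. cmod ((wave t s w j \<omega> - wave t s w i \<omega>) * of_real (f \<omega>)))"
    by (rule integral_norm_bound)
  also have "\<dots> \<le> expectation (\<lambda>\<omega>. cmod (wave t s w j \<omega> - wave t s w i \<omega>) * b)"
  proof (rule integral_mono)
    show "cmod ((wave t s w j \<omega> - wave t s w i \<omega>) * of_real (f \<omega>))
        \<le> cmod (wave t s w j \<omega> - wave t s w i \<omega>) * b" for \<omega>
      unfolding norm_mult using b by (auto intro!: mult_left_mono)
    then show "integrable M (\<lambda>\<omega>. cmod ((wave t s w j \<omega> - wave t s w i \<omega>) * of_real (f \<omega>)))"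
      by (intro Bochner_Integration.integrable_bound[OF int[of b]] AE_I2)
         (auto intro: order_trans[OF _ abs_ge_self])
  qed (rule int)
  also have "\<dots> = expectation (\<lambda>\<omega>. cmod (wave t s w j \<omega> - wave t s w i \<omega>)) * b"
    by simp
  also have "\<dots> \<le> (\<bar>t\<bar> * real (j - i) * \<eta> * \<kappa>) * b"
    using order_trans[OF abs_ge_zero b[of undefined]]
    by (intro mult_right_mono expectation_cmod_wave_diff_le ij w)
  finally show ?thesis .
qed

section \<open>Decorrelation of products and the one-step expansion\<close>

abbreviation covar :: "int \<Rightarrow> int \<Rightarrow> real" where
  "covar i j \<equiv> expectation (\<lambda>\<omega>. \<xi> i \<omega> * \<xi> j \<omega>)"

lemma abs_covar_le: "\<bar>covar i j\<bar> \<le> \<kappa>\<^sup>2"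
  by (rule order_trans[OF integral_abs_bound expectation_abs_mult])

text \<open>
  Covariances decay because \<open>\<xi>\<^sub>i\<close> itself is a function of the past up to \<open>i\<close>.
\<close>
lemma abs_covar_le_rate:
  assumes "1 \<le> n" "i + int n \<le> j"
  shows "\<bar>covar i j\<bar> \<le> 2 * \<kappa> * \<rho> n"
proof -
  have "(\<lambda>\<omega>. complex_of_real (\<xi> i \<omega>)) \<in> borel_measurable (past M \<xi> i)"
    using measurable_past[of i i \<xi> M] by measurable
  from covariance_future[OF assms this]
  have "cmod (expectation (\<lambda>\<omega>. complex_of_real (\<xi> i \<omega> * \<xi> j \<omega>)))
      \<le> 2 * sqrt (expectation (\<lambda>\<omega>. (\<xi> i \<omega>)\<^sup>2)) * \<rho> n"
    by (simp add: square_integrable)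
  also have "\<dots> \<le> 2 * \<kappa> * \<rho> n"
    by (intro mult_right_mono mult_left_mono L2_le rate_nonneg) auto
  finally show ?thesis by (simp del: of_real_mult)
qed

text \<open>
  Three errors are made small in turn. Truncation at a level \<open>A\<close> changes the product little in \<open>L\<^sup>1\<close>.
  With \<open>A\<close> fixed, a gap of length \<open>n\<close> makes the truncated product almost uncorrelated with the past
  before the gap. With \<open>n\<close> fixed, small weights make it harmless to drop the \<open>n\<close> summands in the gap
  from the phase. The bound on the weights depends neither on the position nor on \<open>j - i\<close>.
\<close>
lemma product_decorrelates:
  assumes "0 < \<delta>"
  shows "\<exists>\<eta>>0. \<forall>s w i j. (\<forall>l. \<bar>w l\<bar> \<le> \<eta>) \<longrightarrow> i \<le> j \<longrightarrow>
    cmod (expectation (\<lambda>\<omega>. wave t s w i \<omega> *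
      of_real (\<xi> (s + int i) \<omega> * \<xi> (s + int j) \<omega> - covar (s + int i) (s + int j)))) \<le> \<delta>"
proof -
  \<comment> \<open>Adding \<open>1\<close> in the denominators covers degenerate factors such as \<open>\<kappa> = 0\<close> or \<open>t = 0\<close>.\<close>
  define \<tau> where "\<tau> = \<delta> / (16 * (\<kappa> + 1))"
  have \<tau>: "0 < \<tau>" "4 * \<tau> * \<kappa> \<le> \<delta> / 4"
    using assms \<kappa>_nonneg by (auto simp: \<tau>_def field_simps)
  obtain A where A: "1 \<le> A"
    and tail: "\<And>i. expectation (\<lambda>\<omega>. (\<xi> i \<omega>)\<^sup>2 * indicator {A<..} \<bar>\<xi> i \<omega>\<bar>) \<le> \<tau>\<^sup>2"
    using uniform_square_tail[of "\<tau>\<^sup>2"] \<tau>(1) by auto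
  have "eventually (\<lambda>n. \<rho> n < \<delta> / (32 * A)) sequentially"
    using summable_LIMSEQ_zero[OF rate_summable] assms A by (intro order_tendstoD(2)) auto
  then obtain n where n: "1 \<le> n" "\<rho> n < \<delta> / (32 * A)"
    unfolding eventually_sequentially by (metis nat_le_linear)
  have n2: "8 * A * \<rho> n \<le> \<delta> / 4"
    using n(2) A by (simp add: field_simps)
  define C where "C = \<bar>t\<bar> * real n * \<kappa> * (2 * A\<^sup>2)"
  have C: "0 \<le> C" using \<kappa>_nonneg by (simp add: C_def)
  define \<eta> where "\<eta> = \<delta> / (4 * (C + 1))"
  have \<eta>: "0 < \<eta>" "C * \<eta> \<le> \<delta> / 4"
    using assms C by (auto simp: \<eta>_def field_simps)
  have main: "cmod (expectation (\<lambda>\<omega>. wave t s w i \<omega> *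
      of_real (\<xi> (s + int i) \<omega> * \<xi> (s + int j) \<omega> - covar (s + int i) (s + int j)))) \<le> \<delta>"
    if w: "\<And>l. \<bar>w l\<bar> \<le> \<eta>" and ij: "i \<le> j" for s w i j
  proof -
    let ?x = "\<xi> (s + int i)" and ?y = "\<xi> (s + int j)"
    define a where "a \<omega> = ?x \<omega> * ?y \<omega>" for \<omega>
    define b where "b \<omega> = trunc A (?x \<omega>) * trunc A (?y \<omega>)" for \<omega>
    define l where "l = i - n"
    have [measurable]: "a \<in> borel_measurable M" "b \<in> borel_measurable M"
      unfolding a_def[abs_def] b_def[abs_def] by measurable
    have a: "integrable M a" unfolding a_def[abs_def] by (rule integrable_mult)
    have ble: "\<bar>b \<omega>\<bar> \<le> A\<^sup>2" for \<omega>
      unfolding b_def abs_mult power2_eq_square using A by (intro mult_mono abs_trunc_le) auto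
    have b: "integrable M b"
      by (rule integrable_const_bound[where B="A\<^sup>2"]) (use ble in auto)
    have Eb: "\<bar>expectation b\<bar> \<le> A\<^sup>2"
      using order_trans[OF integral_abs_bound integral_mono[OF integrable_abs[OF b] _ ble]]
      by (simp add: prob_space)
    have ab: "expectation (\<lambda>\<omega>. \<bar>a \<omega> - b \<omega>\<bar>) \<le> 2 * \<tau> * \<kappa>"
    proof -
      have "\<bar>a \<omega> - b \<omega>\<bar> \<le> \<bar>?x \<omega>\<bar> * indicator {A<..} \<bar>?x \<omega>\<bar> * \<bar>?y \<omega>\<bar>
          + \<bar>?y \<omega>\<bar> * indicator {A<..} \<bar>?y \<omega>\<bar> * \<bar>?x \<omega>\<bar>" for \<omega>
      proof -
        have "a \<omega> - b \<omega> = (?x \<omega> - trunc A (?x \<omega>)) * ?y \<omega> + (?y \<omega> - trunc A (?y \<omega>)) * trunc A (?x \<omega>)"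
          by (simp add: a_def b_def algebra_simps)
        then have "\<bar>a \<omega> - b \<omega>\<bar> \<le> \<bar>?x \<omega> - trunc A (?x \<omega>)\<bar> * \<bar>?y \<omega>\<bar>
            + \<bar>?y \<omega> - trunc A (?y \<omega>)\<bar> * \<bar>trunc A (?x \<omega>)\<bar>"
          by (simp only: abs_mult[symmetric] abs_triangle_ineq)
        also have "\<dots> \<le> \<bar>?x \<omega>\<bar> * indicator {A<..} \<bar>?x \<omega>\<bar> * \<bar>?y \<omega>\<bar>
          + \<bar>?y \<omega>\<bar> * indicator {A<..} \<bar>?y \<omega>\<bar> * \<bar>?x \<omega>\<bar>"
          using A by (intro add_mono mult_mono abs_diff_trunc_le abs_trunc_le_abs) auto
        finally show ?thesis .
      qed
      then have "expectation (\<lambda>\<omega>. \<bar>a \<omega> - b \<omega>\<bar>) \<le> expectation (\<lambda>\<omega>.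
          \<bar>?x \<omega>\<bar> * indicator {A<..} \<bar>?x \<omega>\<bar> * \<bar>?y \<omega>\<bar> + \<bar>?y \<omega>\<bar> * indicator {A<..} \<bar>?y \<omega>\<bar> * \<bar>?x \<omega>\<bar>)"
        using tail \<tau>(1) by (intro integral_mono integrable_abs Bochner_Integration.integrable_diff
            Bochner_Integration.integrable_add a b tail_mult(1)) auto
      also have "\<dots> = expectation (\<lambda>\<omega>. \<bar>?x \<omega>\<bar> * indicator {A<..} \<bar>?x \<omega>\<bar> * \<bar>?y \<omega>\<bar>)
          + expectation (\<lambda>\<omega>. \<bar>?y \<omega>\<bar> * indicator {A<..} \<bar>?y \<omega>\<bar> * \<bar>?x \<omega>\<bar>)"
        using tail \<tau>(1) by (intro Bochner_Integration.integral_add tail_mult(1)) auto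
      also have "\<dots> \<le> \<tau> * \<kappa> + \<tau> * \<kappa>"
        using tail \<tau>(1) by (intro add_mono tail_mult(2)) auto
      finally show ?thesis by simp
    qed
    let ?d = "expectation a - expectation b"
    let ?E = "\<lambda>k f. expectation (\<lambda>\<omega>. wave t s w k \<omega> * of_real (f \<omega>))"
    let ?R = "expectation (\<lambda>\<omega>. (wave t s w i \<omega> - wave t s w l \<omega>) * of_real (b \<omega> - expectation b))"
    have 1: "cmod (?E i (\<lambda>\<omega>. (a \<omega> - b \<omega>) - ?d)) \<le> \<delta> / 4"
    proof -
      have "cmod (?E i (\<lambda>\<omega>. (a \<omega> - b \<omega>) - ?d)) \<le> expectation (\<lambda>\<omega>. \<bar>(a \<omega> - b \<omega>) - ?d\<bar>)"
        using a b by (intro cmod_expectation_wave_mult_le) auto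
      also have "\<dots> \<le> expectation (\<lambda>\<omega>. \<bar>a \<omega> - b \<omega>\<bar> + \<bar>?d\<bar>)"
        using a b by (intro integral_mono abs_triangle_ineq4) auto
      also have "\<dots> = expectation (\<lambda>\<omega>. \<bar>a \<omega> - b \<omega>\<bar>) + \<bar>?d\<bar>"
        using a b by (simp add: prob_space)
      also have "\<bar>?d\<bar> \<le> expectation (\<lambda>\<omega>. \<bar>a \<omega> - b \<omega>\<bar>)"
        using integral_abs_bound[of M "\<lambda>\<omega>. a \<omega> - b \<omega>"] a b by simp
      finally show ?thesis using ab \<tau>(2) by simp
    qed
    have 2: "cmod ?R \<le> \<delta> / 4"
    proof -
      have "\<bar>b \<omega> - expectation b\<bar> \<le> 2 * A\<^sup>2" for \<omega>
        using abs_triangle_ineq4[of "b \<omega>" "expectation b"] ble[of \<omega>] Eb by linarith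
      then have "cmod ?R \<le> \<bar>t\<bar> * real (i - l) * \<eta> * \<kappa> * (2 * A\<^sup>2)"
        by (intro cmod_expectation_wave_diff_mult_le w) (auto simp: l_def)
      also have "\<dots> \<le> \<bar>t\<bar> * real n * \<eta> * \<kappa> * (2 * A\<^sup>2)"
        using \<eta> \<kappa>_nonneg by (intro mult_right_mono mult_left_mono) (auto simp: l_def)
      also have "\<dots> = C * \<eta>" by (simp add: C_def mult_ac)
      finally show ?thesis using \<eta> by simp
    qed
    have 3: "cmod (?E l (\<lambda>\<omega>. b \<omega> - expectation b)) \<le> \<delta> / 4"
    proof -
      \<comment> \<open>If fewer than \<open>n\<close> indices precede \<open>i\<close>, then \<open>l = 0\<close> by truncated subtraction and the phase is constant.\<close>
      have "wave t s w l \<in> borel_measurable (past M \<xi> (s + int i - int n))"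
      proof (cases "n \<le> i")
        case True
        then show ?thesis by (intro measurable_wave_past) (simp add: l_def of_nat_diff)
      next
        case False
        then have "wave t s w l = (\<lambda>_. 1)" by (simp add: l_def fun_eq_iff)
        then show ?thesis by simp
      qed
      then have "cmod (?E l (\<lambda>\<omega>. b \<omega> - expectation b)) \<le> 8 * A * \<rho> n"
        unfolding b_def[abs_def] using n(1) A ij
        by (intro covariance_future_trunc[where p="s + int i - int n"]) auto
      with n2 show ?thesis by simp
    qed
    have "?E i (\<lambda>\<omega>. a \<omega> - expectation a)
        = ?E i (\<lambda>\<omega>. (a \<omega> - b \<omega>) - ?d) + ?E i (\<lambda>\<omega>. b \<omega> - expectation b)"
    proof -
      have "?E i (\<lambda>\<omega>. a \<omega> - expectation a)
          = expectation (\<lambda>\<omega>. wave t s w i \<omega> * of_real ((a \<omega> - b \<omega>) - ?d)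
              + wave t s w i \<omega> * of_real (b \<omega> - expectation b))"
        unfolding distrib_left[symmetric] of_real_add[symmetric] by simp
      also have "\<dots> = ?E i (\<lambda>\<omega>. (a \<omega> - b \<omega>) - ?d) + ?E i (\<lambda>\<omega>. b \<omega> - expectation b)"
        using a b by (intro Bochner_Integration.integral_add integrable_wave_mult
            Bochner_Integration.integrable_diff) auto
      finally show ?thesis .
    qed
    moreover have "?E i (\<lambda>\<omega>. b \<omega> - expectation b) = ?R + ?E l (\<lambda>\<omega>. b \<omega> - expectation b)"
    proof -
      have "?R = ?E i (\<lambda>\<omega>. b \<omega> - expectation b) - ?E l (\<lambda>\<omega>. b \<omega> - expectation b)"
        unfolding left_diff_distrib
        using b by (intro Bochner_Integration.integral_diff integrable_wave_mult
            Bochner_Integration.integrable_diff) auto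
      then show ?thesis by simp
    qed
    ultimately have "?E i (\<lambda>\<omega>. a \<omega> - expectation a)
        = ?E i (\<lambda>\<omega>. (a \<omega> - b \<omega>) - ?d) + ?R + ?E l (\<lambda>\<omega>. b \<omega> - expectation b)" by simp
    then have "cmod (?E i (\<lambda>\<omega>. a \<omega> - expectation a)) \<le> \<delta> / 4 + \<delta> / 4 + \<delta> / 4"
      using 1 2 3 by (simp only:) (intro norm_triangle_le add_mono)
    then show ?thesis using assms by (simp add: a_def[abs_def])
  qed
  with \<eta>(1) show ?thesis by blast
qed

text \<open>
  The Lindeberg step: the third order Taylor error is cubic in the weight where \<open>\<bar>\<xi>\<bar> \<le> A\<close>, and it is
  quadratic with a small factor on the tail.
\<close>
lemma second_order_step:
  assumes "0 < \<delta>"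
  shows "\<exists>\<eta>>0. \<forall>s w j. (\<forall>l. \<bar>w l\<bar> \<le> \<eta>) \<longrightarrow>
    cmod (expectation (\<lambda>\<omega>. wave t s w (Suc j) \<omega> - wave t s w j \<omega>
      - wave t s w j \<omega> * (\<i> * of_real ((t * w j) * \<xi> (s + int j) \<omega>)
          - of_real (((t * w j) * \<xi> (s + int j) \<omega>)\<^sup>2 / 2)))) \<le> \<delta> * (w j)\<^sup>2"
proof -
  define \<tau> where "\<tau> = \<delta> / (2 * (t\<^sup>2 + 1))"
  have t1: "0 < t\<^sup>2 + 1" by (simp add: add_nonneg_pos)
  have \<tau>: "0 < \<tau>" "t\<^sup>2 * \<tau> \<le> \<delta> / 2"
    using assms t1 by (auto simp: \<tau>_def field_simps)
  obtain A where A: "1 \<le> A"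
    and tail: "\<And>i. expectation (\<lambda>\<omega>. (\<xi> i \<omega>)\<^sup>2 * indicator {A<..} \<bar>\<xi> i \<omega>\<bar>) \<le> \<tau>"
    using uniform_square_tail[OF \<tau>(1)] by auto
  define C where "C = t\<^sup>2 * \<bar>t\<bar> * A * \<kappa>\<^sup>2"
  have C: "0 \<le> C" using A by (simp add: C_def)
  define \<eta> where "\<eta> = \<delta> / (2 * (C + 1))"
  have \<eta>: "0 < \<eta>" "C * \<eta> \<le> \<delta> / 2"
    using assms C by (auto simp: \<eta>_def field_simps)
  have main: "cmod (expectation (\<lambda>\<omega>. wave t s w (Suc j) \<omega> - wave t s w j \<omega>
      - wave t s w j \<omega> * (\<i> * of_real ((t * w j) * \<xi> (s + int j) \<omega>)
          - of_real (((t * w j) * \<xi> (s + int j) \<omega>)\<^sup>2 / 2)))) \<le> \<delta> * (w j)\<^sup>2"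
    if w: "\<And>l. \<bar>w l\<bar> \<le> \<eta>" for s w j
  proof -
    let ?x = "\<xi> (s + int j)"
    let ?f = "\<lambda>\<omega>. wave t s w (Suc j) \<omega> - wave t s w j \<omega>
      - wave t s w j \<omega> * (\<i> * of_real ((t * w j) * ?x \<omega>) - of_real (((t * w j) * ?x \<omega>)\<^sup>2 / 2))"
    let ?g = "\<lambda>\<omega>. (t * w j)\<^sup>2 * (\<bar>t\<bar> * \<eta> * A * (?x \<omega>)\<^sup>2 + (?x \<omega>)\<^sup>2 * indicator {A<..} \<bar>?x \<omega>\<bar>)"
    have "\<bar>t * w j\<bar> \<le> \<bar>t\<bar> * \<eta>" using w[of j] by (simp add: abs_mult mult_left_mono)
    then have le: "cmod (?f \<omega>) \<le> ?g \<omega>" for \<omega>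
    proof -
      have "?f \<omega> = wave t s w j \<omega> * (iexp ((t * w j) * ?x \<omega>) - 1
          - (\<i> * of_real ((t * w j) * ?x \<omega>) - of_real (((t * w j) * ?x \<omega>)\<^sup>2 / 2)))"
        by (simp add: wave_Suc algebra_simps)
      then have "cmod (?f \<omega>) = cmod (iexp ((t * w j) * ?x \<omega>) - 1
          - (\<i> * of_real ((t * w j) * ?x \<omega>) - of_real (((t * w j) * ?x \<omega>)\<^sup>2 / 2)))"
        by (simp only: norm_mult cmod_wave mult_1)
      also have "\<dots> \<le> ?g \<omega>"
        using A \<open>\<bar>t * w j\<bar> \<le> \<bar>t\<bar> * \<eta>\<close> by (intro iexp_second_order_error) auto
      finally show ?thesis .
    qed
    have g: "integrable M ?g"
      by (intro Bochner_Integration.integrable_mult_right Bochner_Integration.integrable_add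
          square_integrable square_tail_integrable)
    have "cmod (expectation ?f) \<le> expectation (\<lambda>\<omega>. cmod (?f \<omega>))"
      by (rule integral_norm_bound)
    also have "\<dots> \<le> expectation ?g"
      using g le order_trans[OF norm_ge_zero le] by (intro integral_mono_AE' AE_I2) blast+
    also have "\<dots> = (t * w j)\<^sup>2 * (\<bar>t\<bar> * \<eta> * A * expectation (\<lambda>\<omega>. (?x \<omega>)\<^sup>2)
        + expectation (\<lambda>\<omega>. (?x \<omega>)\<^sup>2 * indicator {A<..} \<bar>?x \<omega>\<bar>))"
      by (simp add: square_integrable square_tail_integrable)
    also have "\<dots> \<le> (t * w j)\<^sup>2 * (\<bar>t\<bar> * \<eta> * A * \<kappa>\<^sup>2 + \<tau>)"
      using A \<eta> by (intro mult_left_mono add_mono expectation_square_le tail) auto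
    also have "\<dots> = (C * \<eta> + t\<^sup>2 * \<tau>) * (w j)\<^sup>2"
      by (simp add: C_def power_mult_distrib algebra_simps)
    also have "\<dots> \<le> \<delta> * (w j)\<^sup>2"
      using \<eta> \<tau> by (intro mult_right_mono) auto
    finally show ?thesis .
  qed
  with \<eta>(1) show ?thesis by blast
qed

text \<open>
  With \<open>X\<^sub>i = w\<^sub>i \<xi>\<^bsub>s+i\<^esub>\<close>, the contribution of the increment \<open>i\<close> of the phase to \<open>i t E[exp(i t S\<^sub>j) X\<^sub>j]\<close>
  minus its ideal value \<open>- t\<^sup>2 E[X\<^sub>i X\<^sub>j] E[exp(i t S\<^sub>j)]\<close>.
\<close>
definition pair_error :: "real \<Rightarrow> int \<Rightarrow> (nat \<Rightarrow> real) \<Rightarrow> nat \<Rightarrow> nat \<Rightarrow> complex" where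
  "pair_error t s w i j =
     \<i> * of_real (t * w j) * expectation (\<lambda>\<omega>. (wave t s w (Suc i) \<omega> - wave t s w i \<omega>) * of_real (\<xi> (s + int j) \<omega>))
     + of_real (t\<^sup>2 * w i * w j * covar (s + int i) (s + int j)) * expectation (wave t s w j)"

text \<open>
  The increment of the phase is measurable with respect to the past up to \<open>i\<close> and of size
  \<open>\<bar>t w\<^sub>i \<xi>\<^sub>i\<bar>\<close>, so both terms are covariances between that past and \<open>\<xi>\<^sub>j\<close>.
\<close>
lemma pair_error_far:
  assumes ij: "i < j"
  shows "cmod (pair_error t s w i j) \<le> 4 * t\<^sup>2 * \<kappa> * (\<bar>w i\<bar> * \<bar>w j\<bar> * \<rho> (j - i))"
proof -
  let ?Z = "\<lambda>\<omega>. wave t s w (Suc i) \<omega> - wave t s w i \<omega>"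
  let ?x = "\<xi> (s + int i)"
  have le: "(cmod (?Z \<omega>))\<^sup>2 \<le> (t * w i)\<^sup>2 * (?x \<omega>)\<^sup>2" for \<omega>
  proof -
    have "cmod (?Z \<omega>) \<le> \<bar>t * w i * ?x \<omega>\<bar>"
      using cmod_wave_diff_le[of i "Suc i" t s w \<omega>] by (simp add: abs_mult mult.assoc)
    then have "(cmod (?Z \<omega>))\<^sup>2 \<le> \<bar>t * w i * ?x \<omega>\<bar>\<^sup>2" by (intro power_mono) auto
    then show ?thesis by (simp add: power_mult_distrib)
  qed
  have Z2: "integrable M (\<lambda>\<omega>. (cmod (?Z \<omega>))\<^sup>2)"
    by (rule Bochner_Integration.integrable_bound[of _ "\<lambda>\<omega>. (t * w i)\<^sup>2 * (?x \<omega>)\<^sup>2"])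
       (use le in \<open>auto simp: square_integrable\<close>)
  have "expectation (\<lambda>\<omega>. (cmod (?Z \<omega>))\<^sup>2) \<le> expectation (\<lambda>\<omega>. (t * w i)\<^sup>2 * (?x \<omega>)\<^sup>2)"
    by (intro integral_mono Z2 le Bochner_Integration.integrable_mult_right square_integrable)
  also have "\<dots> \<le> (t * w i)\<^sup>2 * \<kappa>\<^sup>2"
    by (simp add: expectation_square_le mult_left_mono)
  finally have "sqrt (expectation (\<lambda>\<omega>. (cmod (?Z \<omega>))\<^sup>2)) \<le> \<bar>t * w i\<bar> * \<kappa>"
    using \<kappa>_nonneg by (intro real_le_lsqrt) (auto simp: power_mult_distrib)
  then have "2 * sqrt (expectation (\<lambda>\<omega>. (cmod (?Z \<omega>))\<^sup>2)) * \<rho> (j - i) \<le> 2 * (\<bar>t * w i\<bar> * \<kappa>) * \<rho> (j - i)"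
    by (intro mult_right_mono mult_left_mono rate_nonneg) auto
  moreover have "cmod (expectation (\<lambda>\<omega>. ?Z \<omega> * of_real (\<xi> (s + int j) \<omega>)))
      \<le> 2 * sqrt (expectation (\<lambda>\<omega>. (cmod (?Z \<omega>))\<^sup>2)) * \<rho> (j - i)"
    using ij by (intro covariance_future[where p="s + int i"] Z2 borel_measurable_diff measurable_wave_past) auto
  ultimately have "cmod (expectation (\<lambda>\<omega>. ?Z \<omega> * of_real (\<xi> (s + int j) \<omega>))) \<le> 2 * (\<bar>t * w i\<bar> * \<kappa>) * \<rho> (j - i)"
    by (rule order_trans[rotated])
  then have "cmod (\<i> * of_real (t * w j) * expectation (\<lambda>\<omega>. ?Z \<omega> * of_real (\<xi> (s + int j) \<omega>)))
      \<le> \<bar>t * w j\<bar> * (2 * (\<bar>t * w i\<bar> * \<kappa>) * \<rho> (j - i))"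
    unfolding norm_mult norm_of_real by (simp add: mult_left_mono)
  moreover
  have "cmod (of_real (t\<^sup>2 * w i * w j * covar (s + int i) (s + int j)) * expectation (wave t s w j))
      \<le> t\<^sup>2 * \<bar>w i\<bar> * \<bar>w j\<bar> * (2 * \<kappa> * \<rho> (j - i)) * 1"
    unfolding norm_mult norm_of_real abs_mult[of _ "covar _ _"]
    using ij \<kappa>_nonneg rate_nonneg[of "j - i"]
    by (intro mult_mono abs_covar_le_rate cmod_expectation_wave_le_1) (auto simp: abs_mult)
  ultimately have "cmod (pair_error t s w i j)
      \<le> \<bar>t * w j\<bar> * (2 * (\<bar>t * w i\<bar> * \<kappa>) * \<rho> (j - i)) + t\<^sup>2 * \<bar>w i\<bar> * \<bar>w j\<bar> * (2 * \<kappa> * \<rho> (j - i)) * 1"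
    unfolding pair_error_def by (rule norm_triangle_le[OF add_mono])
  also have "\<dots> = 4 * t\<^sup>2 * \<kappa> * (\<bar>w i\<bar> * \<bar>w j\<bar> * \<rho> (j - i))"
    by (simp add: abs_mult power2_eq_square[of t])
  finally show ?thesis .
qed

text \<open>
  Replacing the increment of the phase by its linear part leaves \<open>- t\<^sup>2 E[exp(i t S\<^sub>i) X\<^sub>i X\<^sub>j]\<close>. The product
  \<open>X\<^sub>i X\<^sub>j\<close> decorrelates from the phase, and \<open>S\<^sub>i\<close> may be exchanged for \<open>S\<^sub>j\<close> since only \<open>R\<close> summands of
  small weight lie in between.
\<close>
lemma pair_error_near:
  assumes "0 < \<delta>"
  shows "\<exists>\<eta>>0. \<forall>s w i j. (\<forall>l. \<bar>w l\<bar> \<le> \<eta>) \<longrightarrow> i < j \<longrightarrow> j - i \<le> R \<longrightarrow>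
    cmod (pair_error t s w i j) \<le> \<delta> * (\<bar>w i\<bar> * \<bar>w j\<bar>)"
proof -
  define D where "D = \<delta> / (4 * (t\<^sup>2 + 1))"
  have t1: "0 < t\<^sup>2 + 1" by (simp add: add_nonneg_pos)
  have D: "0 < D" "t\<^sup>2 * (4 * D) \<le> \<delta>"
    using assms t1 by (auto simp: D_def field_simps)
  define \<tau> where "\<tau> = D / (2 * (\<kappa> + 1))"
  have \<tau>: "0 < \<tau>" "2 * (\<tau> * \<kappa>) \<le> D"
    using D \<kappa>_nonneg by (auto simp: \<tau>_def field_simps)
  obtain A where A: "1 \<le> A"
    and tail: "\<And>i. expectation (\<lambda>\<omega>. (\<xi> i \<omega>)\<^sup>2 * indicator {A<..} \<bar>\<xi> i \<omega>\<bar>) \<le> \<tau>\<^sup>2"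
    using uniform_square_tail[of "\<tau>\<^sup>2"] \<tau>(1) by auto
  obtain \<eta>\<^sub>1 where \<eta>\<^sub>1: "0 < \<eta>\<^sub>1"
    and decorr: "\<And>s w i j. (\<And>l. \<bar>w l\<bar> \<le> \<eta>\<^sub>1) \<Longrightarrow> i \<le> j \<Longrightarrow>
      cmod (expectation (\<lambda>\<omega>. wave t s w i \<omega> *
        of_real (\<xi> (s + int i) \<omega> * \<xi> (s + int j) \<omega> - covar (s + int i) (s + int j)))) \<le> D"
    using product_decorrelates[OF D(1), of t] by blast
  define C where "C = \<bar>t\<bar> * A * \<kappa>\<^sup>2 + \<bar>t\<bar> * real R * \<kappa> * \<kappa>\<^sup>2"
  have C: "0 \<le> \<bar>t\<bar> * A * \<kappa>\<^sup>2" "0 \<le> \<bar>t\<bar> * real R * \<kappa> * \<kappa>\<^sup>2" using A \<kappa>_nonneg by simp_all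
  define \<eta> where "\<eta> = min \<eta>\<^sub>1 (D / (C + 1))"
  have \<eta>: "0 < \<eta>" "\<eta> \<le> \<eta>\<^sub>1"
    using D C \<eta>\<^sub>1 by (auto simp: \<eta>_def C_def add_nonneg_pos)
  have C\<eta>: "\<bar>t\<bar> * \<eta> * A * \<kappa>\<^sup>2 + \<bar>t\<bar> * real R * \<eta> * \<kappa> * \<kappa>\<^sup>2 \<le> D"
  proof -
    have "0 < C + 1" using C by (simp add: C_def add_nonneg_pos)
    moreover have "\<eta> \<le> D / (C + 1)" by (simp add: \<eta>_def)
    ultimately have "\<eta> * (C + 1) \<le> D" by (simp add: pos_le_divide_eq)
    then have "C * \<eta> \<le> D" using \<eta> by (simp add: algebra_simps)
    then show ?thesis by (simp add: C_def algebra_simps)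
  qed
  have main: "cmod (pair_error t s w i j) \<le> \<delta> * (\<bar>w i\<bar> * \<bar>w j\<bar>)"
    if w: "\<And>l. \<bar>w l\<bar> \<le> \<eta>" and ij: "i < j" "j - i \<le> R" for s w i j
  proof -
    let ?x = "\<xi> (s + int i)" and ?y = "\<xi> (s + int j)"
    let ?m = "covar (s + int i) (s + int j)"
    let ?c = "t * w i"
    define e where "e \<omega> = wave t s w i \<omega> * (iexp (?c * ?x \<omega>) - 1 - \<i> * of_real (?c * ?x \<omega>))" for \<omega>
    let ?g = "\<lambda>\<omega>. \<bar>?c\<bar> * (\<bar>t\<bar> * \<eta> * A * \<bar>?x \<omega> * ?y \<omega>\<bar>
      + 2 * (\<bar>?x \<omega>\<bar> * indicator {A<..} \<bar>?x \<omega>\<bar> * \<bar>?y \<omega>\<bar>))"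
    have c: "\<bar>?c\<bar> \<le> \<bar>t\<bar> * \<eta>" using w[of i] by (simp add: abs_mult mult_left_mono)
    have e_le: "cmod (e \<omega> * of_real (?y \<omega>)) \<le> ?g \<omega>" for \<omega>
    proof -
      have "cmod (e \<omega> * of_real (?y \<omega>)) = cmod (iexp (?c * ?x \<omega>) - 1 - \<i> * of_real (?c * ?x \<omega>)) * \<bar>?y \<omega>\<bar>"
        unfolding e_def norm_mult cmod_wave norm_of_real by simp
      also have "\<dots> \<le> (\<bar>?c\<bar> * (\<bar>t\<bar> * \<eta> * A * \<bar>?x \<omega>\<bar> + 2 * (\<bar>?x \<omega>\<bar> * indicator {A<..} \<bar>?x \<omega>\<bar>))) * \<bar>?y \<omega>\<bar>"
        using A by (intro mult_right_mono iexp_first_order_error c) auto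
      finally show ?thesis by (simp add: abs_mult algebra_simps)
    qed
    have g: "integrable M ?g"
      using tail \<tau>(1) by (intro Bochner_Integration.integrable_mult_right Bochner_Integration.integrable_add
          integrable_abs integrable_mult tail_mult(1)) auto
    have ei: "integrable M (\<lambda>\<omega>. e \<omega> * of_real (?y \<omega>))"
    proof (rule Bochner_Integration.integrable_bound[OF g])
      show "(\<lambda>\<omega>. e \<omega> * of_real (?y \<omega>)) \<in> borel_measurable M"
        unfolding e_def by measurable
      show "AE \<omega> in M. norm (e \<omega> * of_real (?y \<omega>)) \<le> norm (?g \<omega>)"
        using e_le order_trans[OF e_le abs_ge_self] by auto
    qed
    have Ee: "cmod (expectation (\<lambda>\<omega>. e \<omega> * of_real (?y \<omega>))) \<le> \<bar>?c\<bar> * (\<bar>t\<bar> * \<eta> * A * \<kappa>\<^sup>2 + 2 * (\<tau> * \<kappa>))"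
    proof -
      have "cmod (expectation (\<lambda>\<omega>. e \<omega> * of_real (?y \<omega>))) \<le> expectation (\<lambda>\<omega>. cmod (e \<omega> * of_real (?y \<omega>)))"
        by (rule integral_norm_bound)
      also have "\<dots> \<le> expectation ?g"
        by (intro integral_mono integrable_norm ei g e_le)
      also have "\<dots> = \<bar>?c\<bar> * (\<bar>t\<bar> * \<eta> * A * expectation (\<lambda>\<omega>. \<bar>?x \<omega> * ?y \<omega>\<bar>)
          + 2 * expectation (\<lambda>\<omega>. \<bar>?x \<omega>\<bar> * indicator {A<..} \<bar>?x \<omega>\<bar> * \<bar>?y \<omega>\<bar>))"
        using tail[of "s + int i"] \<tau>(1)
        by (subst Bochner_Integration.integral_mult_right_zero, subst Bochner_Integration.integral_add)
           (auto intro!: tail_mult(1) Bochner_Integration.integrable_mult_right integrable_abs integrable_mult)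
      also have "\<dots> \<le> \<bar>?c\<bar> * (\<bar>t\<bar> * \<eta> * A * \<kappa>\<^sup>2 + 2 * (\<tau> * \<kappa>))"
        using A \<eta> tail[of "s + int i"] \<tau>(1)
        by (intro mult_left_mono add_mono expectation_abs_mult tail_mult(2)) auto
      finally show ?thesis .
    qed
    let ?P = "expectation (\<lambda>\<omega>. wave t s w i \<omega> * of_real (?x \<omega> * ?y \<omega> - ?m))"
    have xy: "integrable M (\<lambda>\<omega>. wave t s w i \<omega> * of_real (?x \<omega> * ?y \<omega>))"
      by (intro integrable_wave_mult integrable_mult)
    have P: "?P = expectation (\<lambda>\<omega>. wave t s w i \<omega> * of_real (?x \<omega> * ?y \<omega>)) - expectation (wave t s w i) * of_real ?m"
      using xy integrable_wave[of t s w i] by (simp add: right_diff_distrib)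
    have "expectation (\<lambda>\<omega>. (wave t s w (Suc i) \<omega> - wave t s w i \<omega>) * of_real (?y \<omega>))
        = expectation (\<lambda>\<omega>. \<i> * of_real ?c * (wave t s w i \<omega> * of_real (?x \<omega> * ?y \<omega>)) + e \<omega> * of_real (?y \<omega>))"
      by (intro Bochner_Integration.integral_cong) (auto simp: wave_Suc e_def algebra_simps)
    also have "\<dots> = \<i> * of_real ?c * expectation (\<lambda>\<omega>. wave t s w i \<omega> * of_real (?x \<omega> * ?y \<omega>))
        + expectation (\<lambda>\<omega>. e \<omega> * of_real (?y \<omega>))"
      by (subst Bochner_Integration.integral_add)
         (use xy ei in \<open>auto intro: Bochner_Integration.integrable_mult_right simp del: of_real_mult\<close>)
    also have "expectation (\<lambda>\<omega>. wave t s w i \<omega> * of_real (?x \<omega> * ?y \<omega>))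
        = ?P + expectation (wave t s w i) * of_real ?m" using P by simp
    finally have eq: "pair_error t s w i j
        = \<i> * of_real (t * w j) * expectation (\<lambda>\<omega>. e \<omega> * of_real (?y \<omega>))
          - of_real (t\<^sup>2 * w i * w j) * ?P
          + of_real (t\<^sup>2 * w i * w j * ?m) * (expectation (wave t s w j) - expectation (wave t s w i))"
      unfolding pair_error_def by (simp add: algebra_simps power2_eq_square)
    have 1: "cmod (\<i> * of_real (t * w j) * expectation (\<lambda>\<omega>. e \<omega> * of_real (?y \<omega>)))
        \<le> \<bar>t * w j\<bar> * (\<bar>?c\<bar> * (\<bar>t\<bar> * \<eta> * A * \<kappa>\<^sup>2 + 2 * (\<tau> * \<kappa>)))"
      unfolding norm_mult norm_of_real using Ee by (simp add: mult_left_mono)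
    have 2: "cmod (of_real (t\<^sup>2 * w i * w j) * ?P) \<le> \<bar>t\<^sup>2 * w i * w j\<bar> * D"
      unfolding norm_mult norm_of_real
      using w \<eta>(2) ij by (intro mult_left_mono decorr) (auto intro: order_trans)
    have 3: "cmod (of_real (t\<^sup>2 * w i * w j * ?m) * (expectation (wave t s w j) - expectation (wave t s w i)))
        \<le> \<bar>t\<^sup>2 * w i * w j\<bar> * (\<bar>t\<bar> * real R * \<eta> * \<kappa> * \<kappa>\<^sup>2)"
    proof -
      have "cmod (expectation (wave t s w j) - expectation (wave t s w i))
          = cmod (expectation (\<lambda>\<omega>. wave t s w j \<omega> - wave t s w i \<omega>))"
        by (simp add: integrable_wave)
      also have "\<dots> \<le> expectation (\<lambda>\<omega>. cmod (wave t s w j \<omega> - wave t s w i \<omega>))"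
        by (rule integral_norm_bound)
      also have "\<dots> \<le> \<bar>t\<bar> * real (j - i) * \<eta> * \<kappa>"
        using ij w by (intro expectation_cmod_wave_diff_le) auto
      also have "\<dots> \<le> \<bar>t\<bar> * real R * \<eta> * \<kappa>"
        using ij \<eta> \<kappa>_nonneg by (intro mult_right_mono mult_left_mono) auto
      finally have "cmod (of_real ?m * (expectation (wave t s w j) - expectation (wave t s w i)))
          \<le> \<kappa>\<^sup>2 * (\<bar>t\<bar> * real R * \<eta> * \<kappa>)"
        unfolding norm_mult norm_of_real by (intro mult_mono abs_covar_le) auto
      from mult_left_mono[OF this abs_ge_zero[of "t\<^sup>2 * w i * w j"]]
      show ?thesis by (simp add: norm_mult norm_power abs_mult mult_ac)
    qed
    have "cmod (pair_error t s w i j)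
        \<le> \<bar>t * w j\<bar> * (\<bar>?c\<bar> * (\<bar>t\<bar> * \<eta> * A * \<kappa>\<^sup>2 + 2 * (\<tau> * \<kappa>))) + \<bar>t\<^sup>2 * w i * w j\<bar> * D
          + \<bar>t\<^sup>2 * w i * w j\<bar> * (\<bar>t\<bar> * real R * \<eta> * \<kappa> * \<kappa>\<^sup>2)"
      unfolding eq by (intro norm_triangle_le add_mono norm_triangle_le_diff 1 2 3)
    also have "\<dots> = t\<^sup>2 * (\<bar>w i\<bar> * \<bar>w j\<bar>) *
        ((\<bar>t\<bar> * \<eta> * A * \<kappa>\<^sup>2 + \<bar>t\<bar> * real R * \<eta> * \<kappa> * \<kappa>\<^sup>2) + 2 * (\<tau> * \<kappa>) + D)"
    proof -
      have "\<bar>t * w j\<bar> * \<bar>?c\<bar> = t\<^sup>2 * (\<bar>w i\<bar> * \<bar>w j\<bar>)"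
        by (simp add: abs_mult power2_eq_square mult_ac)
      moreover have "\<bar>t\<^sup>2 * w i * w j\<bar> = t\<^sup>2 * (\<bar>w i\<bar> * \<bar>w j\<bar>)"
        by (simp add: abs_mult)
      ultimately show ?thesis by (simp only: mult.assoc[symmetric]) (simp add: algebra_simps)
    qed
    also have "\<dots> \<le> t\<^sup>2 * (\<bar>w i\<bar> * \<bar>w j\<bar>) * (4 * D)"
      using C\<eta> \<tau> D by (intro mult_left_mono) auto
    also have "\<dots> = (t\<^sup>2 * (4 * D)) * (\<bar>w i\<bar> * \<bar>w j\<bar>)" by simp
    also have "\<dots> \<le> \<delta> * (\<bar>w i\<bar> * \<bar>w j\<bar>)"
      using D by (intro mult_right_mono) auto
    finally show ?thesis .
  qed
  with \<eta>(1) show ?thesis by blast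
qed

section \<open>The perturbed Gaussian recursion\<close>

text \<open>
  The increment of the variance from \<open>S\<^sub>j\<close> to \<open>S\<^bsub>j+1\<^esub>\<close>; it may be negative.
\<close>
definition var_increment :: "int \<Rightarrow> (nat \<Rightarrow> real) \<Rightarrow> nat \<Rightarrow> real" where
  "var_increment s w j = (w j)\<^sup>2 * covar (s + int j) (s + int j)
     + 2 * (\<Sum>i<j. w i * w j * covar (s + int i) (s + int j))"

lemma psum_mult_integrable: "integrable M (\<lambda>\<omega>. psum s w j \<omega> * \<xi> i \<omega>)"
  unfolding psum_def sum_distrib_right mult.assoc
  by (intro Bochner_Integration.integrable_sum Bochner_Integration.integrable_mult_right integrable_mult)

lemma psum_square:
  "integrable M (\<lambda>\<omega>. (psum s w N \<omega>)\<^sup>2) \<and>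
   expectation (\<lambda>\<omega>. (psum s w N \<omega>)\<^sup>2) = (\<Sum>j<N. var_increment s w j)"
proof (induction N)
  case 0
  then show ?case by (simp add: psum_def)
next
  case (Suc N)
  let ?x = "\<xi> (s + int N)"
  have eq: "(psum s w (Suc N) \<omega>)\<^sup>2
      = (psum s w N \<omega>)\<^sup>2 + (2 * w N * (psum s w N \<omega> * ?x \<omega>) + (w N)\<^sup>2 * (?x \<omega> * ?x \<omega>))" for \<omega>
    by (simp add: psum_def power2_eq_square algebra_simps)
  have "expectation (\<lambda>\<omega>. psum s w N \<omega> * ?x \<omega>) = (\<Sum>i<N. w i * covar (s + int i) (s + int N))"
    unfolding psum_def sum_distrib_right mult.assoc
    by (simp add: integrable_mult)
  moreover have "expectation (\<lambda>\<omega>. (psum s w (Suc N) \<omega>)\<^sup>2)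
      = expectation (\<lambda>\<omega>. (psum s w N \<omega>)\<^sup>2)
        + (2 * w N * expectation (\<lambda>\<omega>. psum s w N \<omega> * ?x \<omega>) + (w N)\<^sup>2 * covar (s + int N) (s + int N))"
    unfolding eq using Suc psum_mult_integrable[of s w N "s + int N"] integrable_mult[of "s + int N" "s + int N"]
    by (simp del: mult.assoc mult.left_commute mult.commute)
  moreover have "2 * w N * (\<Sum>i<N. w i * covar (s + int i) (s + int N))
      = 2 * (\<Sum>i<N. w i * w N * covar (s + int i) (s + int N))"
    unfolding sum_distrib_left by (intro sum.cong) auto
  ultimately have "expectation (\<lambda>\<omega>. (psum s w (Suc N) \<omega>)\<^sup>2)
      = (\<Sum>j<N. var_increment s w j) + var_increment s w N"
    using Suc by (simp add: var_increment_def)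
  with Suc show ?case
    unfolding eq using psum_mult_integrable integrable_mult by simp
qed

text \<open>
  An exact identity: telescoping the phase in \<open>E[exp(i t S\<^sub>j) X\<^sub>j]\<close> from \<open>S\<^sub>0 = 0\<close>, where the term
  \<open>E[X\<^sub>j]\<close> vanishes, produces all the covariances in the variance increment.
\<close>
lemma expectation_wave_step:
  fixes t s w j
  defines "y \<equiv> \<xi> (s + int j)"
  shows "expectation (wave t s w (Suc j)) = of_real (1 - t\<^sup>2 / 2 * var_increment s w j) * expectation (wave t s w j)
    + (expectation (\<lambda>\<omega>. wave t s w (Suc j) \<omega> - wave t s w j \<omega>
         - wave t s w j \<omega> * (\<i> * of_real ((t * w j) * y \<omega>) - of_real (((t * w j) * y \<omega>)\<^sup>2 / 2)))
       - of_real (t\<^sup>2 / 2 * (w j)\<^sup>2) * expectation (\<lambda>\<omega>. wave t s w j \<omega> *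
           of_real (y \<omega> * y \<omega> - covar (s + int j) (s + int j)))
       + (\<Sum>i<j. pair_error t s w i j))"
proof -
  let ?u = "\<lambda>j. expectation (wave t s w j)"
  let ?m = "\<lambda>i. covar (s + int i) (s + int j)"
  let ?L = "\<lambda>j. expectation (\<lambda>\<omega>. wave t s w j \<omega> * of_real (y \<omega>))"
  let ?Q = "expectation (\<lambda>\<omega>. wave t s w j \<omega> * of_real (y \<omega> * y \<omega>))"
  have L: "integrable M (\<lambda>\<omega>. wave t s w i \<omega> * of_real (y \<omega>))" for i
    unfolding y_def by (intro integrable_wave_mult integrable)
  have Q: "integrable M (\<lambda>\<omega>. wave t s w i \<omega> * of_real (y \<omega> * y \<omega>))" for i
    unfolding y_def by (intro integrable_wave_mult integrable_mult)
  have taylor: "expectation (\<lambda>\<omega>. wave t s w (Suc j) \<omega> - wave t s w j \<omega>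
         - wave t s w j \<omega> * (\<i> * of_real ((t * w j) * y \<omega>) - of_real (((t * w j) * y \<omega>)\<^sup>2 / 2)))
      = ?u (Suc j) - ?u j - (\<i> * of_real (t * w j) * ?L j - of_real ((t * w j)\<^sup>2 / 2) * ?Q)"
  proof -
    have "(\<lambda>\<omega>. wave t s w (Suc j) \<omega> - wave t s w j \<omega>
         - wave t s w j \<omega> * (\<i> * of_real ((t * w j) * y \<omega>) - of_real (((t * w j) * y \<omega>)\<^sup>2 / 2)))
        = (\<lambda>\<omega>. wave t s w (Suc j) \<omega> - wave t s w j \<omega>
          - (\<i> * of_real (t * w j) * (wave t s w j \<omega> * of_real (y \<omega>))
             - of_real ((t * w j)\<^sup>2 / 2) * (wave t s w j \<omega> * of_real (y \<omega> * y \<omega>))))"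
      by (simp add: fun_eq_iff power2_eq_square algebra_simps)
    then show ?thesis
      using L[of j] Q[of j] integrable_wave[of t s w]
      by (simp only: Bochner_Integration.integral_diff Bochner_Integration.integrable_diff
          Bochner_Integration.integrable_mult_right Bochner_Integration.integral_mult_right_zero)
  qed
  have square: "expectation (\<lambda>\<omega>. wave t s w j \<omega> * of_real (y \<omega> * y \<omega> - ?m j)) = ?Q - ?u j * of_real (?m j)"
    using Q[of j] integrable_wave[of t s w j] by (simp add: right_diff_distrib)
  have pairs: "(\<Sum>i<j. pair_error t s w i j)
      = \<i> * of_real (t * w j) * ?L j + of_real (t\<^sup>2 * (\<Sum>i<j. w i * w j * ?m i)) * ?u j"
  proof -
    have "(\<Sum>i<j. expectation (\<lambda>\<omega>. (wave t s w (Suc i) \<omega> - wave t s w i \<omega>) * of_real (y \<omega>)))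
        = (\<Sum>i<j. ?L (Suc i) - ?L i)"
      using L by (intro sum.cong) (simp_all add: left_diff_distrib)
    also have "\<dots> = ?L j - ?L 0" by (rule sum_lessThan_telescope)
    also have "?L 0 = 0" by (simp add: y_def centered)
    finally have tele: "(\<Sum>i<j. expectation (\<lambda>\<omega>. (wave t s w (Suc i) \<omega> - wave t s w i \<omega>) * of_real (y \<omega>))) = ?L j"
      by simp
    show ?thesis
      unfolding pair_error_def sum.distrib y_def[symmetric] tele[symmetric]
      by (simp only: sum_distrib_left sum_distrib_right of_real_sum mult.assoc)
  qed
  define S where "S = (\<Sum>i<j. w i * w j * ?m i)"
  have cancel: "U' = (1 - T\<^sup>2 / 2 * (W\<^sup>2 * m + 2 * S)) * U
      + (U' - U - (\<i> * (T * W) * A - (T * W)\<^sup>2 / 2 * Q) - T\<^sup>2 / 2 * W\<^sup>2 * (Q - U * m)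
         + (\<i> * (T * W) * A + T\<^sup>2 * S * U))" for U U' T W m S A Q :: complex
    by (simp add: field_simps)
  show ?thesis
    unfolding taylor square pairs var_increment_def S_def[symmetric]
    using cancel[of "?u (Suc j)" "of_real t" "of_real (w j)" "of_real (?m j)" "of_real S" "?u j" "?L j" ?Q]
    by (simp only: of_real_diff of_real_add of_real_mult of_real_divide of_real_power of_real_1 of_real_numeral)
qed

lemma sum_rate_le: "finite F \<Longrightarrow> sum \<rho> F \<le> suminf \<rho>"
  by (intro sum_le_suminf rate_summable rate_nonneg) auto

lemma abs_var_increment_le:
  "\<bar>var_increment s w j\<bar> \<le> \<kappa>\<^sup>2 * (w j)\<^sup>2 + 4 * \<kappa> * (\<Sum>i<j. \<bar>w i\<bar> * \<bar>w j\<bar> * \<rho> (j - i))"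
proof -
  have "\<bar>var_increment s w j\<bar> \<le> \<bar>(w j)\<^sup>2 * covar (s + int j) (s + int j)\<bar>
      + \<bar>2 * (\<Sum>i<j. w i * w j * covar (s + int i) (s + int j))\<bar>"
    unfolding var_increment_def by (rule abs_triangle_ineq)
  also have "\<bar>(w j)\<^sup>2 * covar (s + int j) (s + int j)\<bar> \<le> \<kappa>\<^sup>2 * (w j)\<^sup>2"
    using mult_left_mono[OF abs_covar_le[of "s + int j" "s + int j"], of "(w j)\<^sup>2"]
    unfolding abs_mult by (simp add: mult.commute)
  also have "\<bar>2 * (\<Sum>i<j. w i * w j * covar (s + int i) (s + int j))\<bar>
      \<le> 2 * (\<Sum>i<j. \<bar>w i\<bar> * \<bar>w j\<bar> * (2 * \<kappa> * \<rho> (j - i)))"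
  proof -
    have "\<bar>\<Sum>i<j. w i * w j * covar (s + int i) (s + int j)\<bar>
        \<le> (\<Sum>i<j. \<bar>w i\<bar> * \<bar>w j\<bar> * \<bar>covar (s + int i) (s + int j)\<bar>)"
      by (rule order_trans[OF sum_abs]) (simp add: abs_mult)
    also have "\<dots> \<le> (\<Sum>i<j. \<bar>w i\<bar> * \<bar>w j\<bar> * (2 * \<kappa> * \<rho> (j - i)))"
      by (intro sum_mono mult_left_mono abs_covar_le_rate) auto
    finally show ?thesis by simp
  qed
  finally show ?thesis by (simp add: sum_distrib_left mult_ac)
qed

text \<open>
  A quantitative central limit theorem, uniform over all positions, lengths and weights with bounded
  sum of squares. Pairs at distance at most \<open>R\<close> use the near bound and all others the far
  bound, so the kernel \<open>h\<close> below has small total mass once \<open>R\<close> is large and then the weights are small.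
\<close>
lemma wave_near_gaussian:
  assumes \<epsilon>: "0 < \<epsilon>" and B: "0 \<le> B"
  shows "\<exists>\<eta>>0. \<forall>s w N. (\<forall>l. \<bar>w l\<bar> \<le> \<eta>) \<longrightarrow> (\<Sum>j<N. (w j)\<^sup>2) \<le> B \<longrightarrow>
    cmod (expectation (wave t s w N)
      - of_real (exp (- (t\<^sup>2 / 2 * expectation (\<lambda>\<omega>. (psum s w N \<omega>)\<^sup>2))))) \<le> \<epsilon>"
proof -
  define G where "G = suminf \<rho>"
  have G: "0 \<le> G" unfolding G_def by (intro suminf_nonneg rate_summable rate_nonneg)
  define \<Gamma> where "\<Gamma> = t\<^sup>2 / 2 * (\<kappa>\<^sup>2 + 4 * \<kappa> * G)"
  have \<Gamma>: "0 \<le> \<Gamma>" using G \<kappa>_nonneg by (simp add: \<Gamma>_def)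
  define C where "C = exp (\<Gamma> * B)"
  have C: "1 \<le> C" using \<Gamma> B by (simp add: C_def)
  \<comment> \<open>The total error is \<open>C B\<close> times five contributions of size \<open>D\<close>: one from the Taylor expansion, one from
    the squares, two from the pairs and one from the squares of the increments \<open>v\<^sub>j\<close>.\<close>
  define D where "D = \<epsilon> / (5 * C * (B + 1))"
  have D: "0 < D" using \<epsilon> B C by (simp add: D_def)
  have D\<epsilon>: "C * (5 * D * B) \<le> \<epsilon>"
  proof -
    have "C * (5 * D * B) \<le> C * (5 * D * (B + 1))" using C D by (intro mult_left_mono) auto
    also have "\<dots> = \<epsilon>" using C B by (simp add: D_def)
    finally show ?thesis .
  qed
  define K where "K = 4 * t\<^sup>2 * \<kappa>"
  have K: "0 \<le> K" using \<kappa>_nonneg by (simp add: K_def)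
  have "0 < D / (K + 1)" using D K by (simp add: add_nonneg_pos)
  then obtain R where R: "\<And>m n. R \<le> m \<Longrightarrow> \<bar>sum \<rho> {m..<n}\<bar> < D / (K + 1)"
    using rate_summable unfolding summable_Cauchy by (metis real_norm_def)
  define \<delta> where "\<delta> = D / (real R + 1)"
  have \<delta>: "0 < \<delta>" "(real R + 1) * \<delta> = D" using D by (auto simp: \<delta>_def)
  define h where "h r = (if r \<le> R then \<delta> else K * \<rho> r)" for r
  have h: "0 \<le> h r" for r using \<delta> K rate_nonneg[of r] by (simp add: h_def)
  have sum_h: "sum h F \<le> 2 * D" if F: "finite F" for F
  proof -
    have "sum h F = sum h (F \<inter> {..R}) + sum h (F - {..R})"
      using F by (metis add.commute sum.Int_Diff)
    also have "sum h (F \<inter> {..R}) \<le> sum (\<lambda>_. \<delta>) {..R}"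
    proof -
      have "sum h (F \<inter> {..R}) = sum (\<lambda>_. \<delta>) (F \<inter> {..R})"
        by (rule sum.cong) (auto simp: h_def)
      also have "\<dots> \<le> sum (\<lambda>_. \<delta>) {..R}"
        using \<delta> by (intro sum_mono2) auto
      finally show ?thesis .
    qed
    also have "\<dots> = D" using \<delta> by (simp add: add.commute)
    also have "sum h (F - {..R}) = K * sum \<rho> (F - {..R})"
      unfolding sum_distrib_left by (rule sum.cong) (auto simp: h_def)
    also have "\<dots> \<le> K * (D / (K + 1))"
    proof (intro mult_left_mono K)
      have "sum \<rho> (F - {..R}) \<le> sum \<rho> {Suc R..<Suc (Max (insert 0 F))}"
        using F rate_nonneg by (intro sum_mono2) (auto simp: less_Suc_eq_le)
      also have "\<dots> < D / (K + 1)" by (rule le_less_trans[OF abs_ge_self R]) simp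
      finally show "sum \<rho> (F - {..R}) \<le> D / (K + 1)" by simp
    qed
    also have "\<dots> \<le> D" using K D by (simp add: field_simps)
    finally show ?thesis by simp
  qed
  obtain \<eta>\<^sub>1 where \<eta>\<^sub>1: "0 < \<eta>\<^sub>1" and step: "\<And>s w j. (\<And>l. \<bar>w l\<bar> \<le> \<eta>\<^sub>1) \<Longrightarrow>
    cmod (expectation (\<lambda>\<omega>. wave t s w (Suc j) \<omega> - wave t s w j \<omega>
      - wave t s w j \<omega> * (\<i> * of_real ((t * w j) * \<xi> (s + int j) \<omega>)
          - of_real (((t * w j) * \<xi> (s + int j) \<omega>)\<^sup>2 / 2)))) \<le> D * (w j)\<^sup>2"
    using second_order_step[OF D, where t=t] by blast
  have t1: "0 < t\<^sup>2 + 1" by (simp add: add_nonneg_pos)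
  then have "0 < D / (t\<^sup>2 + 1)" using D by simp
  from product_decorrelates[OF this, where t=t]
  obtain \<eta>\<^sub>2 where \<eta>\<^sub>2: "0 < \<eta>\<^sub>2" and diag: "\<And>s w i j. (\<And>l. \<bar>w l\<bar> \<le> \<eta>\<^sub>2) \<Longrightarrow> i \<le> j \<Longrightarrow>
    cmod (expectation (\<lambda>\<omega>. wave t s w i \<omega> *
      of_real (\<xi> (s + int i) \<omega> * \<xi> (s + int j) \<omega> - covar (s + int i) (s + int j)))) \<le> D / (t\<^sup>2 + 1)"
    by blast
  obtain \<eta>\<^sub>3 where \<eta>\<^sub>3: "0 < \<eta>\<^sub>3" and near: "\<And>s w i j. (\<And>l. \<bar>w l\<bar> \<le> \<eta>\<^sub>3) \<Longrightarrow> i < j \<Longrightarrow> j - i \<le> R \<Longrightarrow>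
    cmod (pair_error t s w i j) \<le> \<delta> * (\<bar>w i\<bar> * \<bar>w j\<bar>)"
    using pair_error_near[OF \<delta>(1), where t=t and R=R] by blast
  define \<eta> where "\<eta> = Min {\<eta>\<^sub>1, \<eta>\<^sub>2, \<eta>\<^sub>3, 1, D / (\<Gamma>\<^sup>2 + 1), 1 / (\<Gamma> + 1)}"
  have \<Gamma>2: "0 < \<Gamma>\<^sup>2 + 1" by (simp add: add_nonneg_pos)
  have \<eta>: "0 < \<eta>" "\<eta> \<le> \<eta>\<^sub>1" "\<eta> \<le> \<eta>\<^sub>2" "\<eta> \<le> \<eta>\<^sub>3" "\<eta> \<le> 1" "\<eta> \<le> D / (\<Gamma>\<^sup>2 + 1)" "\<eta> \<le> 1 / (\<Gamma> + 1)"
    using \<eta>\<^sub>1 \<eta>\<^sub>2 \<eta>\<^sub>3 D \<Gamma> \<Gamma>2 by (auto simp: \<eta>_def)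
  have \<Gamma>\<eta>: "\<Gamma> * \<eta> \<le> 1" "\<Gamma>\<^sup>2 * \<eta> \<le> D"
  proof -
    have "\<eta> * (\<Gamma> + 1) \<le> 1" using \<eta>(7) \<Gamma> by (simp add: pos_le_divide_eq)
    then show "\<Gamma> * \<eta> \<le> 1" using \<eta>(1) by (simp add: algebra_simps)
    have "\<eta> * (\<Gamma>\<^sup>2 + 1) \<le> D" using \<eta>(6) \<Gamma>2 by (simp add: pos_le_divide_eq)
    then show "\<Gamma>\<^sup>2 * \<eta> \<le> D" using \<eta>(1) by (simp add: algebra_simps)
  qed
  have main: "cmod (expectation (wave t s w N)
      - of_real (exp (- (t\<^sup>2 / 2 * expectation (\<lambda>\<omega>. (psum s w N \<omega>)\<^sup>2))))) \<le> \<epsilon>"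
    if w: "\<And>l. \<bar>w l\<bar> \<le> \<eta>" and wB: "(\<Sum>j<N. (w j)\<^sup>2) \<le> B" for s w N
  proof -
    define v where "v j = t\<^sup>2 / 2 * var_increment s w j" for j
    define r where "r j = expectation (\<lambda>\<omega>. wave t s w (Suc j) \<omega> - wave t s w j \<omega>
        - wave t s w j \<omega> * (\<i> * of_real ((t * w j) * \<xi> (s + int j) \<omega>)
            - of_real (((t * w j) * \<xi> (s + int j) \<omega>)\<^sup>2 / 2)))
       - of_real (t\<^sup>2 / 2 * (w j)\<^sup>2) * expectation (\<lambda>\<omega>. wave t s w j \<omega> *
           of_real (\<xi> (s + int j) \<omega> * \<xi> (s + int j) \<omega> - covar (s + int j) (s + int j)))
       + (\<Sum>i<j. pair_error t s w i j)" for j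
    have v_le: "\<bar>v j\<bar> \<le> t\<^sup>2 / 2 * (\<kappa>\<^sup>2 * (w j)\<^sup>2 + 4 * \<kappa> * (\<Sum>i<j. \<bar>w i\<bar> * \<bar>w j\<bar> * \<rho> (j - i)))" for j
      unfolding v_def abs_mult by (intro mult_mono abs_var_increment_le) auto
    have v\<eta>: "\<bar>v j\<bar> \<le> \<Gamma> * \<eta>" for j
    proof -
      have ww: "\<bar>w i\<bar> * \<bar>w j\<bar> \<le> \<eta>" for i
        using mult_mono[of "\<bar>w i\<bar>" \<eta> "\<bar>w j\<bar>" 1] w[of i] w[of j] \<eta> by auto
      have "(w j)\<^sup>2 \<le> \<eta>" using ww[of j] by (simp add: power2_eq_square abs_mult_self_eq)
      moreover have "(\<Sum>i<j. \<bar>w i\<bar> * \<bar>w j\<bar> * \<rho> (j - i)) \<le> (\<Sum>i<j. \<eta> * \<rho> (j - i))"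
        by (intro sum_mono mult_right_mono ww rate_nonneg)
      moreover have "(\<Sum>i<j. \<eta> * \<rho> (j - i)) \<le> \<eta> * G"
        unfolding sum_distrib_left[symmetric] G_def
        using \<eta>(1) by (intro mult_left_mono sum_reindexed_le[OF sum_rate_le]) (auto intro: inj_onI)
      ultimately have "\<kappa>\<^sup>2 * (w j)\<^sup>2 + 4 * \<kappa> * (\<Sum>i<j. \<bar>w i\<bar> * \<bar>w j\<bar> * \<rho> (j - i))
          \<le> \<kappa>\<^sup>2 * \<eta> + 4 * \<kappa> * (\<eta> * G)"
        using \<kappa>_nonneg by (intro add_mono mult_left_mono) auto
      then have "\<bar>v j\<bar> \<le> t\<^sup>2 / 2 * (\<kappa>\<^sup>2 * \<eta> + 4 * \<kappa> * (\<eta> * G))"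
        by (intro order_trans[OF v_le] mult_left_mono) auto
      also have "\<dots> = \<Gamma> * \<eta>" by (simp add: \<Gamma>_def algebra_simps)
      finally show ?thesis .
    qed
    have sum_v: "(\<Sum>j<N. \<bar>v j\<bar>) \<le> \<Gamma> * B"
    proof -
      have "(\<Sum>j<N. \<bar>v j\<bar>) \<le> (\<Sum>j<N. t\<^sup>2 / 2 * (\<kappa>\<^sup>2 * (w j)\<^sup>2 + 4 * \<kappa> * (\<Sum>i<j. \<bar>w i\<bar> * \<bar>w j\<bar> * \<rho> (j - i))))"
        by (intro sum_mono v_le)
      also have "\<dots> = t\<^sup>2 / 2 * (\<kappa>\<^sup>2 * (\<Sum>j<N. (w j)\<^sup>2)
          + 4 * \<kappa> * (\<Sum>j<N. \<Sum>i<j. \<bar>w i\<bar> * \<bar>w j\<bar> * \<rho> (j - i)))"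
        by (simp only: sum_distrib_left sum.distrib distrib_left)
      also have "\<dots> \<le> t\<^sup>2 / 2 * (\<kappa>\<^sup>2 * B + 4 * \<kappa> * (G * B))"
      proof -
        have "(\<Sum>j<N. \<Sum>i<j. \<bar>w i\<bar> * \<bar>w j\<bar> * \<rho> (j - i)) \<le> G * (\<Sum>j<N. (w j)\<^sup>2)"
          unfolding G_def by (intro sum_convolution_le rate_nonneg sum_rate_le)
        also have "\<dots> \<le> G * B" using G wB by (intro mult_left_mono)
        finally show ?thesis using wB \<kappa>_nonneg by (intro mult_left_mono add_mono) auto
      qed
      also have "\<dots> = \<Gamma> * B" by (simp add: \<Gamma>_def algebra_simps)
      finally show ?thesis .
    qed
    have sum_v2: "(\<Sum>j<N. (v j)\<^sup>2) \<le> D * B"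
    proof -
      have "(\<Sum>j<N. (v j)\<^sup>2) \<le> (\<Sum>j<N. (\<Gamma> * \<eta>) * \<bar>v j\<bar>)"
      proof (intro sum_mono)
        fix j show "(v j)\<^sup>2 \<le> (\<Gamma> * \<eta>) * \<bar>v j\<bar>"
          using mult_right_mono[OF v\<eta>[of j] abs_ge_zero[of "v j"]] by (simp add: power2_eq_square)
      qed
      also have "\<dots> \<le> (\<Gamma> * \<eta>) * (\<Gamma> * B)"
        unfolding sum_distrib_left[symmetric] using \<Gamma> \<eta> by (intro mult_left_mono sum_v) auto
      also have "\<dots> = (\<Gamma>\<^sup>2 * \<eta>) * B" by (simp add: power2_eq_square)
      also have "\<dots> \<le> D * B" using \<Gamma>\<eta> B by (intro mult_right_mono)
      finally show ?thesis .
    qed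
    have r_le: "cmod (r j) \<le> 2 * D * (w j)\<^sup>2 + (\<Sum>i<j. \<bar>w i\<bar> * \<bar>w j\<bar> * h (j - i))" for j
    proof -
      have 1: "cmod (expectation (\<lambda>\<omega>. wave t s w (Suc j) \<omega> - wave t s w j \<omega>
        - wave t s w j \<omega> * (\<i> * of_real ((t * w j) * \<xi> (s + int j) \<omega>)
            - of_real (((t * w j) * \<xi> (s + int j) \<omega>)\<^sup>2 / 2)))) \<le> D * (w j)\<^sup>2"
        using w \<eta>(2) by (intro step) (auto intro: order_trans)
      have 2: "cmod (of_real (t\<^sup>2 / 2 * (w j)\<^sup>2) * expectation (\<lambda>\<omega>. wave t s w j \<omega> *
           of_real (\<xi> (s + int j) \<omega> * \<xi> (s + int j) \<omega> - covar (s + int j) (s + int j)))) \<le> D * (w j)\<^sup>2"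
      proof -
        have "cmod (of_real (t\<^sup>2 / 2 * (w j)\<^sup>2) * expectation (\<lambda>\<omega>. wave t s w j \<omega> *
           of_real (\<xi> (s + int j) \<omega> * \<xi> (s + int j) \<omega> - covar (s + int j) (s + int j))))
           \<le> \<bar>t\<^sup>2 / 2 * (w j)\<^sup>2\<bar> * (D / (t\<^sup>2 + 1))"
          unfolding norm_mult norm_of_real using w \<eta>(3)
          by (intro mult_left_mono diag) (auto intro: order_trans)
        also have "\<dots> = (t\<^sup>2 / 2 * (D / (t\<^sup>2 + 1))) * (w j)\<^sup>2" by simp
        also have "\<dots> \<le> D * (w j)\<^sup>2"
        proof (intro mult_right_mono)
          have "t\<^sup>2 * D \<le> 2 * (D * (t\<^sup>2 + 1))" using D mult_nonneg_nonneg[of "t\<^sup>2" D] by (simp add: algebra_simps)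
          then show "t\<^sup>2 / 2 * (D / (t\<^sup>2 + 1)) \<le> D" using t1 by (simp add: field_simps)
        qed auto
        finally show ?thesis .
      qed
      have 3: "cmod (\<Sum>i<j. pair_error t s w i j) \<le> (\<Sum>i<j. \<bar>w i\<bar> * \<bar>w j\<bar> * h (j - i))"
      proof (rule order_trans[OF norm_sum], intro sum_mono)
        fix i assume "i \<in> {..<j}"
        then have ij: "i < j" by simp
        show "cmod (pair_error t s w i j) \<le> \<bar>w i\<bar> * \<bar>w j\<bar> * h (j - i)"
        proof (cases "j - i \<le> R")
          case True
          then show ?thesis
            using near[of w i j s] w \<eta>(4) ij by (auto simp: h_def mult_ac intro: order_trans)
        next
          case False
          then show ?thesis using pair_error_far[OF ij, of t s w] by (simp add: h_def K_def mult_ac)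
        qed
      qed
      have "cmod (r j) \<le> D * (w j)\<^sup>2 + D * (w j)\<^sup>2 + (\<Sum>i<j. \<bar>w i\<bar> * \<bar>w j\<bar> * h (j - i))"
        unfolding r_def by (intro norm_triangle_le add_mono norm_triangle_le_diff 1 2 3)
      then show ?thesis by simp
    qed
    have sum_r: "(\<Sum>j<N. cmod (r j)) \<le> 4 * D * B"
    proof -
      have "(\<Sum>j<N. cmod (r j)) \<le> (\<Sum>j<N. 2 * D * (w j)\<^sup>2 + (\<Sum>i<j. \<bar>w i\<bar> * \<bar>w j\<bar> * h (j - i)))"
        by (intro sum_mono r_le)
      also have "\<dots> \<le> 2 * D * (\<Sum>j<N. (w j)\<^sup>2) + 2 * D * (\<Sum>j<N. (w j)\<^sup>2)"
        unfolding sum.distrib sum_distrib_left[symmetric]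
        by (intro add_mono order_refl sum_convolution_le h sum_h)
      also have "\<dots> = 4 * D * (\<Sum>j<N. (w j)\<^sup>2)" by simp
      also have "\<dots> \<le> 4 * D * B" using D wB by (intro mult_left_mono) auto
      finally show ?thesis .
    qed
    have V: "(\<Sum>j<N. v j) = t\<^sup>2 / 2 * expectation (\<lambda>\<omega>. (psum s w N \<omega>)\<^sup>2)"
      using psum_square[of s w N] by (simp add: v_def sum_distrib_left)
    have "cmod (expectation (wave t s w N) - of_real (exp (- (\<Sum>j<N. v j))))
        \<le> C * (\<Sum>j<N. cmod (r j) + (v j)\<^sup>2)"
    proof (rule perturbed_exponential_recursion)
      show "expectation (wave t s w 0) = 1" unfolding wave_def[abs_def] psum_def by (simp add: prob_space)
      show "cmod (expectation (wave t s w j)) \<le> 1" for j by (rule cmod_expectation_wave_le_1)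
      show "expectation (wave t s w (Suc j)) = of_real (1 - v j) * expectation (wave t s w j) + r j" for j
        unfolding r_def v_def by (rule expectation_wave_step)
      show "\<bar>v j\<bar> \<le> 1" for j using v\<eta>[of j] \<Gamma>\<eta>(1) by simp
      show "exp (\<Sum>j<n. v j) \<le> C" if "n \<le> N" for n
      proof -
        have "(\<Sum>j<n. v j) \<le> (\<Sum>j<n. \<bar>v j\<bar>)" by (intro sum_mono) simp
        also have "\<dots> \<le> (\<Sum>j<N. \<bar>v j\<bar>)" using that by (intro sum_mono2) auto
        finally show ?thesis using sum_v by (simp add: C_def)
      qed
      show "0 \<le> (\<Sum>j<N. v j)" unfolding V by simp
    qed
    also have "\<dots> \<le> C * (4 * D * B + D * B)"
      using C sum_r sum_v2 unfolding sum.distrib by (intro mult_left_mono add_mono) auto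
    also have "\<dots> \<le> \<epsilon>" using D\<epsilon> by (simp add: algebra_simps)
    finally show ?thesis unfolding V .
  qed
  with \<eta>(1) show ?thesis by blast
qed

end

section \<open>The central limit theorem\<close>

lemma summable_rate:
  fixes g :: "real \<Rightarrow> real"
  assumes nonneg: "\<And>x. 0 < x \<Longrightarrow> 0 \<le> g x"
    and mono: "antimono_on {0<..} (\<lambda>x. x powr (3/2) * g x)"
  shows "summable (\<lambda>n. g (real (Suc n)))"
proof (rule summable_comparison_test')
  show "summable (\<lambda>n. g 1 * real (Suc n) powr (- (3/2)))"
  proof (rule summable_mult)
    have "summable (\<lambda>n. real n powr (- (3/2)))" by (simp add: summable_real_powr_iff)
    then show "summable (\<lambda>n. real (Suc n) powr (- (3/2)))" by (subst summable_Suc_iff)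
  qed
  fix n :: nat
  have "real (Suc n) powr (3/2) * g (real (Suc n)) \<le> 1 powr (3/2) * g 1"
    by (rule monotone_onD[OF mono]) auto
  then have "g (real (Suc n)) \<le> g 1 * real (Suc n) powr (- (3/2))"
    by (simp add: powr_minus field_simps)
  then show "norm (g (real (Suc n))) \<le> g 1 * real (Suc n) powr (- (3/2))"
    using nonneg[of "real (Suc n)"] by simp
qed

theorem theorem3p1:
  fixes M :: "'a measure"
    and \<xi> :: "int \<Rightarrow> 'a \<Rightarrow> real"
    and k :: "nat \<Rightarrow> nat"
    and a :: "nat \<Rightarrow> int \<Rightarrow> real"
    and g :: "real \<Rightarrow> real"
  assumes "prob_space M"
    and "\<And>i. \<xi> i \<in> borel_measurable M"
    and "\<And>i. integrable M (\<lambda>\<omega>. (\<xi> i \<omega>)\<^sup>2)"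
    and "\<And>i. prob_space.expectation M (\<xi> i) = 0"
    and "\<And>i. \<not> (\<exists>c. AE \<omega> in M. \<xi> i \<omega> = c)"
    and "\<And>n. 1 \<le> n \<Longrightarrow> 0 < k n"
    and "mono_on {1..} k"
    and "filterlim k at_top sequentially"
    and "\<And>n. 1 \<le> n \<Longrightarrow> (\<Sum>i=-int (k n)..int (k n). (a n i)\<^sup>2) > 0"
    and A1_i: "liminf (\<lambda>n. ereal ((array_sd M k a \<xi> n)\<^sup>2
                 / (\<Sum>i=-int (k n)..int (k n). (a n i)\<^sup>2))) > 0"
    and A1_ii: "(\<lambda>n. inverse (array_sd M k a \<xi> n)
                 * (MAX i\<in>{-int (k n)..int (k n)}. \<bar>a n i\<bar>)) \<longlonglongrightarrow> 0"
    and A2: "uniformly_integrable M UNIV (\<lambda>i \<omega>. (\<xi> i \<omega>)\<^sup>2)"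
    and A3_nonneg: "\<And>x. 0 < x \<Longrightarrow> 0 \<le> g x"
    and A3_bound: "\<And>n::nat. 1 \<le> n \<Longrightarrow> theta M \<xi> n \<le> ennreal (g (real n))"
    and A3_mono: "antimono_on {0<..} (\<lambda>x. x powr (3/2) * g x)"
    and A3_sum: "\<exists>\<epsilon>. 0 < \<epsilon> \<and> \<epsilon> < 1 \<and>
                   summable (\<lambda>i::nat. 2 powr (3 * real i / 2) * g (2 powr (real i * \<epsilon>)))"
  shows "weak_conv_m
           (\<lambda>n. distr M borel (\<lambda>\<omega>. array_sum k a \<xi> n \<omega> / array_sd M k a \<xi> n))
           std_normal_distribution"
proof -
  interpret prob_space M by fact
  \<comment> \<open>\<open>g 0\<close> is unconstrained, so the rate at gap \<open>0\<close> is set to \<open>0\<close>.\<close>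
  define \<rho> where "\<rho> n = (if n = 0 then 0 else g (real n))" for n :: nat
  interpret theta_dependent M \<xi> \<rho>
  proof unfold_locales
    show "summable \<rho>"
      using summable_rate[OF A3_nonneg A3_mono] by (subst summable_Suc_iff[symmetric]) (simp add: \<rho>_def)
  qed (use assms in \<open>auto simp: \<rho>_def\<close>)
  let ?I = "\<lambda>n. {-int (k n)..int (k n)}"
  define \<sigma> where "\<sigma> n = array_sd M k a \<xi> n" for n
  have [measurable]: "array_sum k a \<xi> n \<in> borel_measurable M" for n
    unfolding array_sum_def[abs_def] by measurable
  \<comment> \<open>Setting the weights to \<open>0\<close> outside the row makes the bound on their size hold for every index.\<close>
  define w where "w n i = (if i < 2 * k n + 1 then a n (int i - int (k n)) / \<sigma> n else 0)" for n i
  have reindex: "(\<Sum>i\<in>?I n. f i) = (\<Sum>i<2 * k n + 1. f (int i - int (k n)))" for f :: "int \<Rightarrow> real" and n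
    by (rule sum.reindex_bij_witness[of _ "\<lambda>i. int i - int (k n)" "\<lambda>i. nat (i + int (k n))"]) auto
  have psum_eq: "array_sum k a \<xi> n \<omega> / \<sigma> n = psum (- int (k n)) (w n) (2 * k n + 1) \<omega>" for n \<omega>
    unfolding array_sum_def reindex psum_def sum_divide_distrib by (intro sum.cong) (auto simp: w_def)
  have variance_eq: "variance (array_sum k a \<xi> n) = expectation (\<lambda>\<omega>. (array_sum k a \<xi> n \<omega>)\<^sup>2)" for n
  proof -
    have "expectation (array_sum k a \<xi> n) = 0"
      unfolding array_sum_def[abs_def] by (simp add: integrable centered)
    then show ?thesis by simp
  qed
  obtain c where c: "0 < c"
    "ereal c < liminf (\<lambda>n. ereal ((\<sigma> n)\<^sup>2 / (\<Sum>i\<in>?I n. (a n i)\<^sup>2)))"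
    using ereal_dense2[OF A1_i] by (auto simp: \<sigma>_def)
  have pos: "eventually (\<lambda>n. 0 < \<sigma> n \<and> (\<Sum>i\<in>?I n. (a n i)\<^sup>2) \<le> (\<sigma> n)\<^sup>2 / c) sequentially"
    using less_LiminfD[OF c(2)] eventually_ge_at_top[of 1]
  proof eventually_elim
    case (elim n)
    have "0 < (\<Sum>i\<in>?I n. (a n i)\<^sup>2)" using elim assms(9) by blast
    with elim(1) c(1) have less: "c * (\<Sum>i\<in>?I n. (a n i)\<^sup>2) < (\<sigma> n)\<^sup>2"
      and "0 < c * (\<Sum>i\<in>?I n. (a n i)\<^sup>2)" by (simp_all add: pos_less_divide_eq)
    then have "\<sigma> n \<noteq> 0" by auto
    moreover have "0 \<le> \<sigma> n" unfolding \<sigma>_def array_sd_def variance_eq by simp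
    ultimately show ?case using less c(1) by (simp add: pos_le_divide_eq mult.commute)
  qed
  show ?thesis
  proof (rule levy_continuity)
    show "real_distribution (distr M borel (\<lambda>\<omega>. array_sum k a \<xi> n \<omega> / array_sd M k a \<xi> n))" for n
      by (rule real_distribution_distr) measurable
    show "real_distribution std_normal_distribution" by (rule real_dist_normal_dist)
    fix t
    have char_eq: "char (distr M borel (\<lambda>\<omega>. array_sum k a \<xi> n \<omega> / array_sd M k a \<xi> n)) t
        = expectation (wave t (- int (k n)) (w n) (2 * k n + 1))" for n
      unfolding char_def wave_def[abs_def] psum_eq[symmetric] \<sigma>_def
      by (subst integral_distr) auto
    show "(\<lambda>n. char (distr M borel (\<lambda>\<omega>. array_sum k a \<xi> n \<omega> / array_sd M k a \<xi> n)) t)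
        \<longlonglongrightarrow> char std_normal_distribution t"
      unfolding char_eq
    proof (rule tendstoI)
      fix \<epsilon> :: real assume "0 < \<epsilon>"
      then obtain \<eta> where \<eta>: "0 < \<eta>" and near: "\<And>s w N. (\<And>l. \<bar>w l\<bar> \<le> \<eta>) \<Longrightarrow> (\<Sum>j<N. (w j)\<^sup>2) \<le> 1 / c \<Longrightarrow>
          cmod (expectation (wave t s w N)
            - of_real (exp (- (t\<^sup>2 / 2 * expectation (\<lambda>\<omega>. (psum s w N \<omega>)\<^sup>2))))) \<le> \<epsilon> / 2"
        using wave_near_gaussian[of "\<epsilon> / 2" "1 / c", where t=t] c(1) by auto
      have "eventually (\<lambda>n. inverse (\<sigma> n) * (MAX i\<in>?I n. \<bar>a n i\<bar>) < \<eta>) sequentially"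
        using A1_ii \<eta> unfolding \<sigma>_def by (rule order_tendstoD)
      with pos show "eventually (\<lambda>n. dist (expectation (wave t (- int (k n)) (w n) (2 * k n + 1)))
          (char std_normal_distribution t) < \<epsilon>) sequentially"
      proof eventually_elim
        case (elim n)
        then have \<sigma>: "0 < \<sigma> n" by simp
        have w_le: "\<bar>w n l\<bar> \<le> \<eta>" for l
        proof (cases "l < 2 * k n + 1")
          case True
          then have "\<bar>a n (int l - int (k n))\<bar> \<le> (MAX i\<in>?I n. \<bar>a n i\<bar>)"
            by (intro Max_ge) auto
          then have "\<bar>w n l\<bar> \<le> inverse (\<sigma> n) * (MAX i\<in>?I n. \<bar>a n i\<bar>)"
            using True \<sigma> by (simp add: w_def divide_inverse abs_mult mult.commute mult_left_mono)
          with elim(2) show ?thesis by simp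
        qed (use \<eta> in \<open>simp add: w_def\<close>)
        have "(\<Sum>j<2 * k n + 1. (w n j)\<^sup>2) = (\<Sum>i\<in>?I n. (a n i)\<^sup>2) / (\<sigma> n)\<^sup>2"
          unfolding reindex sum_divide_distrib by (intro sum.cong) (auto simp: w_def power_divide)
        also have "\<dots> \<le> 1 / c" using elim(1) \<sigma> c(1) by (simp add: field_simps)
        finally have w2: "(\<Sum>j<2 * k n + 1. (w n j)\<^sup>2) \<le> 1 / c" .
        have "(\<sigma> n)\<^sup>2 = variance (array_sum k a \<xi> n)"
          unfolding \<sigma>_def array_sd_def by simp
        then have var: "expectation (\<lambda>\<omega>. (array_sum k a \<xi> n \<omega>)\<^sup>2) = (\<sigma> n)\<^sup>2"
          unfolding variance_eq by simp
        have "expectation (\<lambda>\<omega>. (psum (- int (k n)) (w n) (2 * k n + 1) \<omega>)\<^sup>2) = 1"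
          unfolding psum_eq[symmetric] power_divide using \<sigma> var by simp
        with near[OF w_le w2, of "- int (k n)"]
        show ?case
          using \<open>0 < \<epsilon>\<close> by (simp add: char_std_normal_distribution dist_norm)
      qed
    qed
  qed
qed

end
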